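(* Let $G$ be one of the Polish topological groups $\mathrm{Homeo}_+[0,1]$ or $\mathrm{Iso}(\mathbb{U}_1)$. Then every continuous action of $G$ by affine isometries on a reflexive Banach space is trivial (every element of $G$ acts as the identity).
   Context: $\mathrm{Homeo}_+[0,1]$ is the group of endpoint-preserving homeomorphisms of $[0,1]$ with the compact-open topology. $\mathbb{U}_1$ is a sphere in the universal Urysohn metric space $\mathbb{U}$, namely the sphere of radius $1/2$; equivalently, it is the unique (up to isometry) complete separable metric space of diameter $1$ that contains an isometric copy of every separable metric space of diameter at most $1$ and in which every isometry between finite subspaces extends to a surjective self-isometry. $\mathrm{Iso}(\mathbb{U}_1)$ is the group of surjective self-isometries of $\mathbb{U}_1$ with the topology of pointwise convergence. An action by affine isometries on a Banach space $E$ is a homomorphism to the group of surjective affine isometries of $E$; it is continuous if $G\times E\to E$ is jointly continuous. *)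

theory Defs
  imports "HOL-Analysis.Analysis" "HOL-Algebra.Bij"
begin

section \<open>The group of orientation-preserving homeomorphisms of the unit interval\<close>

text \<open>Self-maps of a set \<open>S\<close> are represented by extensional functions, and groups of such maps are
  obtained from \<^const>\<open>BijGroup\<close> by shrinking the carrier. The group operation is composition.\<close>

lemma group_BijGroup_carrier_update:
  assumes "H \<subseteq> Bij S" "(\<lambda>x\<in>S. x) \<in> H"
    and "\<And>f g. f \<in> H \<Longrightarrow> g \<in> H \<Longrightarrow> compose S f g \<in> H"
    and "\<And>f. f \<in> H \<Longrightarrow> (\<lambda>x\<in>S. inv_into S f x) \<in> H"
  shows "group ((BijGroup S)\<lparr>carrier := H\<rparr>)"
proof -
  interpret B: group "BijGroup S" by (rule group_BijGroup)
  have "subgroup H (BijGroup S)"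
  proof
    show "H \<subseteq> carrier (BijGroup S)" using assms(1) by (simp add: BijGroup_def)
    show "\<one>\<^bsub>BijGroup S\<^esub> \<in> H" using assms(2) by (simp add: BijGroup_def)
    show "f \<otimes>\<^bsub>BijGroup S\<^esub> g \<in> H" if "f \<in> H" "g \<in> H" for f g
      using that assms(1,3) by (auto simp: BijGroup_def subset_iff)
    show "inv\<^bsub>BijGroup S\<^esub> f \<in> H" if "f \<in> H" for f
      using that assms(1,4) by (auto simp: inv_BijGroup subset_iff)
  qed
  then show ?thesis by (rule B.subgroup_imp_group)
qed

definition compact_open_topology :: "'a topology \<Rightarrow> 'b topology \<Rightarrow> ('a \<Rightarrow> 'b) topology" where
  "compact_open_topology X Y =
     (let C = {f. continuous_map X Y f \<and> f \<in> extensional (topspace X)}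
      in topology_generated_by {{f \<in> C. f ` K \<subseteq> V} | K V. compactin X K \<and> openin Y V})"

definition Homeo_plus_I :: "(real \<Rightarrow> real) monoid" where
  "Homeo_plus_I = (BijGroup {0..1})
     \<lparr>carrier := {f \<in> Bij {0..1}. (\<exists>g. homeomorphism {0..1} {0..1} f g) \<and> f 0 = 0 \<and> f 1 = 1}\<rparr>"

definition Homeo_plus_I_topology :: "(real \<Rightarrow> real) topology" where
  "Homeo_plus_I_topology =
     subtopology (compact_open_topology (top_of_set {0..1}) (top_of_set {0..1}))
       (carrier Homeo_plus_I)"

lemma group_Homeo_plus_I: "group Homeo_plus_I"
  unfolding Homeo_plus_I_def
proof (rule group_BijGroup_carrier_update)
  let ?I = "{0..1::real}"
  let ?H = "{f \<in> Bij ?I. (\<exists>g. homeomorphism ?I ?I f g) \<and> f 0 = 0 \<and> f 1 = 1}"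
  show "(\<lambda>x\<in>?I. x) \<in> ?H"
  proof -
    have "homeomorphism ?I ?I (\<lambda>x\<in>?I. x) id"
      by (rule homeomorphism_cong[OF homeomorphism_ident]) auto
    then show ?thesis by (auto simp: id_Bij)
  qed
  show "compose ?I f g \<in> ?H" if fg: "f \<in> ?H" "g \<in> ?H" for f g
  proof -
    obtain f' g' where "homeomorphism ?I ?I f f'" "homeomorphism ?I ?I g g'" using fg by blast
    then have "homeomorphism ?I ?I (f \<circ> g) (g' \<circ> f')" using homeomorphism_compose by blast
    then have "homeomorphism ?I ?I (compose ?I f g) (g' \<circ> f')"
      by (rule homeomorphism_cong) (auto simp: compose_def)
    then show ?thesis using fg compose_Bij[of f ?I g] by (auto simp: compose_def)
  qed
  show "(\<lambda>x\<in>?I. inv_into ?I f x) \<in> ?H" if f: "f \<in> ?H" for f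
  proof -
    obtain g where g: "homeomorphism ?I ?I f g" using f by blast
    have inj: "inj_on f ?I" using f by (simp add: Bij_def bij_betw_def)
    have eq: "inv_into ?I f y = g y" if "y \<in> ?I" for y
      by (rule inv_into_f_eq[OF inj]) (use g that in \<open>auto simp: homeomorphism_def\<close>)
    have "homeomorphism ?I ?I (\<lambda>x\<in>?I. inv_into ?I f x) f"
      by (rule homeomorphism_cong[OF homeomorphism_symD[OF g]]) (auto simp: eq)
    moreover have "inv_into ?I f 0 = 0" "inv_into ?I f 1 = 1"
      using f by (auto intro!: inv_into_f_eq[OF inj])
    ultimately show ?thesis using f restrict_inv_into_Bij[of f ?I] by auto
  qed
qed auto

lemma topspace_compact_open_topology:
  "topspace (compact_open_topology X Y) = {f. continuous_map X Y f \<and> f \<in> extensional (topspace X)}"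
    (is "_ = ?C")
proof -
  have "?C = {f \<in> ?C. f ` {} \<subseteq> {}}" by simp
  moreover have "compactin X {}" "openin Y {}" by auto
  ultimately have "?C \<in> {{f \<in> ?C. f ` K \<subseteq> V} | K V. compactin X K \<and> openin Y V}" by blast
  then have "\<Union> {{f \<in> ?C. f ` K \<subseteq> V} | K V. compactin X K \<and> openin Y V} = ?C" by blast
  then show ?thesis
    by (simp only: compact_open_topology_def Let_def topology_generated_by_topspace)
qed

lemma topspace_Homeo_plus_I_topology: "topspace Homeo_plus_I_topology = carrier Homeo_plus_I"
proof -
  have "carrier Homeo_plus_I \<subseteq> topspace (compact_open_topology (top_of_set {0..1}) (top_of_set {0..1}))"
    unfolding topspace_compact_open_topology
    by (auto simp: Homeo_plus_I_def homeomorphism_def Bij_imp_extensional)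
  then show ?thesis unfolding Homeo_plus_I_topology_def topspace_subtopology by blast
qed


section \<open>Isometry groups and the Urysohn sphere\<close>

definition Iso_group :: "'a set \<Rightarrow> ('a \<Rightarrow> 'a \<Rightarrow> real) \<Rightarrow> ('a \<Rightarrow> 'a) monoid" where
  "Iso_group M d = (BijGroup M)
     \<lparr>carrier := {f \<in> Bij M. \<forall>x\<in>M. \<forall>y\<in>M. d (f x) (f y) = d x y}\<rparr>"

definition Iso_group_topology :: "'a set \<Rightarrow> ('a \<Rightarrow> 'a \<Rightarrow> real) \<Rightarrow> ('a \<Rightarrow> 'a) topology" where
  "Iso_group_topology M d =
     subtopology (product_topology (\<lambda>_. Metric_space.mtopology M d) M) (carrier (Iso_group M d))"

lemma group_Iso_group: "group (Iso_group M d)"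
  unfolding Iso_group_def
proof (rule group_BijGroup_carrier_update)
  let ?H = "{f \<in> Bij M. \<forall>x\<in>M. \<forall>y\<in>M. d (f x) (f y) = d x y}"
  show "(\<lambda>x\<in>M. x) \<in> ?H" by (simp add: id_Bij)
  show "compose M f g \<in> ?H" if fg: "f \<in> ?H" "g \<in> ?H" for f g
  proof -
    have "g x \<in> M" if "x \<in> M" for x using fg that Bij_imp_funcset[of g M] by auto
    then show ?thesis using fg compose_Bij[of f M g] by (auto simp: compose_def)
  qed
  show "(\<lambda>x\<in>M. inv_into M f x) \<in> ?H" if f: "f \<in> ?H" for f
  proof -
    have im: "f ` M = M" using f by (simp add: Bij_def bij_betw_def)
    have "d (inv_into M f x) (inv_into M f y) = d x y" if "x \<in> M" "y \<in> M" for x y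
    proof -
      have "inv_into M f x \<in> M" "inv_into M f y \<in> M" using im that by (auto intro: inv_into_into)
      then have "d (f (inv_into M f x)) (f (inv_into M f y)) = d (inv_into M f x) (inv_into M f y)"
        using f by blast
      then show ?thesis using im that by (simp add: f_inv_into_f)
    qed
    then show ?thesis using f restrict_inv_into_Bij[of f M] by auto
  qed
qed auto

lemma topspace_Iso_group_topology:
  assumes "Metric_space M d"
  shows "topspace (Iso_group_topology M d) = carrier (Iso_group M d)"
proof -
  interpret Metric_space M d by fact
  show ?thesis
    by (auto simp: Iso_group_topology_def Iso_group_def PiE_def Bij_def bij_betw_def)
qed

text \<open>The Urysohn sphere \<open>\<U>\<^sub>1\<close>, by the properties that determine it up to isometry. In the universality
  clause, test spaces carried by sets of reals suffice, because a separable metric space has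
  at most continuum many points; see \<open>urysohn_sphere_universal\<close> below.\<close>

definition urysohn_sphere :: "'a set \<Rightarrow> ('a \<Rightarrow> 'a \<Rightarrow> real) \<Rightarrow> bool" where
  "urysohn_sphere M d \<longleftrightarrow>
     Metric_space M d \<and>
     Metric_space.mcomplete M d \<and>
     separable_space (Metric_space.mtopology M d) \<and>
     bdd_above ((\<lambda>(x, y). d x y) ` (M \<times> M)) \<and> (SUP (x, y)\<in>M \<times> M. d x y) = 1 \<and>
     (\<forall>(N :: real set) e.
        Metric_space N e \<and> separable_space (Metric_space.mtopology N e) \<and>
        (\<forall>x\<in>N. \<forall>y\<in>N. e x y \<le> 1) \<longrightarrow>
        (\<exists>f\<in>N \<rightarrow> M. \<forall>x\<in>N. \<forall>y\<in>N. d (f x) (f y) = e x y)) \<and>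
     (\<forall>A f. finite A \<and> A \<subseteq> M \<and> f \<in> A \<rightarrow> M \<and> (\<forall>x\<in>A. \<forall>y\<in>A. d (f x) (f y) = d x y) \<longrightarrow>
        (\<exists>g \<in> carrier (Iso_group M d). \<forall>x\<in>A. g x = f x))"

lemma urysohn_sphere_universal:
  fixes N :: "'b set"
  assumes U: "urysohn_sphere M d"
    and "Metric_space N e"
    and sep: "separable_space (Metric_space.mtopology N e)"
    and le1: "\<And>x y. x \<in> N \<Longrightarrow> y \<in> N \<Longrightarrow> e x y \<le> 1"
  shows "\<exists>f\<in>N \<rightarrow> M. \<forall>x\<in>N. \<forall>y\<in>N. d (f x) (f y) = e x y"
proof (cases "N = {}")
  case False
  interpret N: Metric_space N e by fact
  obtain C where C: "countable C" "C \<subseteq> N" "Abstract_Topology.closure_of N.mtopology C = N"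
    using sep unfolding separable_space_def by auto
  then have "C \<noteq> {}" using False by auto
  define c where "c = from_nat_into C"
  define h where "h x = {n. e (c (fst (prod_decode n))) x < of_rat (from_nat (snd (prod_decode n)))}" for x
  have "inj_on h N"
  proof (rule inj_onI, rule ccontr)
    fix x y assume xy: "x \<in> N" "y \<in> N" "h x = h y" "x \<noteq> y"
    then have "e x y / 2 > 0" by simp
    then obtain a where a: "a \<in> C" "a \<in> N.mball x (e x y / 2)"
      using C xy(1) unfolding N.metric_closure_of by blast
    then obtain q where q: "e a x < of_rat q" "of_rat q < e x y / 2"
      using of_rat_dense[of "e a x" "e x y / 2"] N.commute by auto
    obtain n where n: "c n = a"
      using a C(1) from_nat_into_surj unfolding c_def by metis
    have "prod_encode (n, to_nat q) \<in> h x" using q n by (simp add: h_def)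
    then have "prod_encode (n, to_nat q) \<in> h y" using xy by simp
    then have "e a y < of_rat q" using n by (simp add: h_def)
    moreover have "e x y \<le> e x a + e a y" using N.triangle xy a C by auto
    ultimately show False using q N.commute[of x a] by linarith
  qed
  moreover obtain i :: "nat set \<Rightarrow> real" where "inj i"
    using nat_sets_eqpoll_reals unfolding eqpoll_def bij_betw_def by auto
  ultimately have inj: "inj_on (i \<circ> h) N" by (simp add: comp_inj_on inj_on_subset)
  define j where "j = i \<circ> h"
  define k where "k = inv_into N j"
  have kj: "k (j x) = x" if "x \<in> N" for x
    using inv_into_f_f[OF inj that] by (simp add: j_def k_def)
  define e' where "e' a b = e (k a) (k b)" for a b
  have N': "Metric_space (j ` N) e'"
    by unfold_locales (auto simp: e'_def kj N.commute N.triangle)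
  interpret P: Metric_space12 N e "j ` N" e'
    using N' by (simp add: Metric_space12_def N.Metric_space_axioms)
  have "homeomorphic_map N.mtopology P.M2.mtopology j"
    by (rule P.isometry_imp_homeomorphic_map) (auto simp: e'_def kj)
  then have "separable_space P.M2.mtopology"
    using sep homeomorphic_separable_space homeomorphic_map_imp_homeomorphic_space by blast
  moreover have "\<forall>x\<in>j ` N. \<forall>y\<in>j ` N. e' x y \<le> 1"
    using le1 by (auto simp: e'_def kj)
  ultimately obtain f where f: "f \<in> j ` N \<rightarrow> M"
      "\<forall>x\<in>j ` N. \<forall>y\<in>j ` N. d (f x) (f y) = e' x y"
    using U[unfolded urysohn_sphere_def, THEN conjunct2, THEN conjunct2, THEN conjunct2,
        THEN conjunct2, THEN conjunct2, THEN conjunct1, rule_format, of "j ` N" e'] N' by auto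
  show ?thesis
    by (rule bexI[of _ "f \<circ> j"]) (use f in \<open>auto simp: e'_def kj\<close>)
qed auto


section \<open>Actions by affine isometries on reflexive Banach spaces\<close>

definition bidual_embedding :: "'e::real_normed_vector \<Rightarrow> ('e \<Rightarrow>\<^sub>L real) \<Rightarrow>\<^sub>L real" where
  "bidual_embedding x = Blinfun (\<lambda>f. blinfun_apply f x)"

definition reflexive_space :: "'e::real_normed_vector itself \<Rightarrow> bool" where
  "reflexive_space _ \<longleftrightarrow> surj (bidual_embedding :: 'e \<Rightarrow> _)"

lemma bidual_embedding_apply: "blinfun_apply (bidual_embedding x) f = blinfun_apply f x"
  unfolding bidual_embedding_def
  by (subst bounded_linear_Blinfun_apply)
     (auto intro: bounded_linear_intros)

definition affine_map :: "('e::real_vector \<Rightarrow> 'e) \<Rightarrow> bool" where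
  "affine_map f \<longleftrightarrow> (\<exists>L b. linear L \<and> f = (\<lambda>x. L x + b))"

definition AffIso_group :: "('e::real_normed_vector \<Rightarrow> 'e) monoid" where
  "AffIso_group = (BijGroup UNIV)
     \<lparr>carrier := {f. surj f \<and> affine_map f \<and> (\<forall>x y. dist (f x) (f y) = dist x y)}\<rparr>"

lemma group_AffIso_group: "group (AffIso_group :: ('e::real_normed_vector \<Rightarrow> 'e) monoid)"
  unfolding AffIso_group_def
proof (rule group_BijGroup_carrier_update)
  let ?H = "{f :: 'e \<Rightarrow> 'e. surj f \<and> affine_map f \<and> (\<forall>x y. dist (f x) (f y) = dist x y)}"
  have inj: "inj f" if "f \<in> ?H" for f
  proof (rule injI)
    fix x y assume "f x = f y"
    then have "dist x y = 0" using that by (metis (mono_tags, lifting) dist_self mem_Collect_eq)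
    then show "x = y" by simp
  qed
  show "?H \<subseteq> Bij UNIV" using inj by (auto simp: Bij_def bij_def)
  have "affine_map (\<lambda>x :: 'e. x)"
    unfolding affine_map_def by (intro exI[of _ "\<lambda>x. x"] exI[of _ 0]) (simp add: linear_id[unfolded id_def])
  then show "(\<lambda>x\<in>UNIV. x) \<in> ?H" by (simp add: restrict_def)
  show "compose UNIV f g \<in> ?H" if fg: "f \<in> ?H" "g \<in> ?H" for f g
  proof -
    obtain L b L' b' where L: "linear L" "f = (\<lambda>x. L x + b)" "linear L'" "g = (\<lambda>x. L' x + b')"
      using fg unfolding affine_map_def by blast
    have "f \<circ> g = (\<lambda>x. (L \<circ> L') x + (L b' + b))"
      using L by (auto simp: linear_add)
    then have "affine_map (f \<circ> g)"
      unfolding affine_map_def using linear_compose[OF L(3,1)] by blast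
    moreover have "surj (f \<circ> g)" using fg comp_surj by blast
    ultimately show ?thesis using fg by (simp add: compose_def comp_def restrict_def)
  qed
  show "(\<lambda>x\<in>UNIV. inv_into UNIV f x) \<in> ?H" if f: "f \<in> ?H" for f
  proof -
    obtain L b where L: "linear L" "f = (\<lambda>x. L x + b)"
      using f unfolding affine_map_def by blast
    have s: "f (inv_into UNIV f y) = y" for y using f by (simp add: surj_f_inv_f)
    have i: "inv_into UNIV f y = x" if "f x = y" for x y using inj[OF f] that by (metis inv_f_f)
    have Lf: "L (inv_into UNIV f y) = y - b" for y using s[of y] L(2) by (simp add: algebra_simps)
    define K where "K y = inv_into UNIV f (y + b)" for y
    have LK: "L (K y) = y" for y by (simp add: K_def Lf)
    have injL: "x = y" if "L x = L y" for x y using injD[OF inj[OF f], of x y] that by (simp add: L(2))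
    have "linear K"
      by (rule linearI; rule injL) (simp_all add: LK linear_add[OF L(1)] linear_cmul[OF L(1)])
    moreover have "inv_into UNIV f y = K y + K (- b)" for y
      using linear_add[OF \<open>linear K\<close>, of y "- b"] by (simp add: K_def)
    ultimately have "affine_map (inv_into UNIV f)" unfolding affine_map_def by blast
    moreover have "dist (inv_into UNIV f x) (inv_into UNIV f y) = dist x y" for x y
      using f s by (metis (mono_tags, lifting) mem_Collect_eq)
    moreover have "surj (inv_into UNIV f)" using inj[OF f] by (rule inj_imp_surj_inv)
    ultimately show ?thesis by (simp add: restrict_def)
  qed
qed

definition continuous_affine_isometric_action ::
    "('g, 'm) monoid_scheme \<Rightarrow> 'g topology \<Rightarrow> ('g \<Rightarrow> 'e::real_normed_vector \<Rightarrow> 'e) \<Rightarrow> bool" where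
  "continuous_affine_isometric_action G T \<alpha> \<longleftrightarrow>
     \<alpha> \<in> hom G AffIso_group \<and>
     continuous_map (prod_topology T euclidean) euclidean (\<lambda>(g, x). \<alpha> g x)"

definition trivial_action :: "('g, 'm) monoid_scheme \<Rightarrow> ('g \<Rightarrow> 'e \<Rightarrow> 'e) \<Rightarrow> bool" where
  "trivial_action G \<alpha> \<longleftrightarrow> (\<forall>g\<in>carrier G. \<forall>x. \<alpha> g x = x)"

end

theory Submission
  imports Defs
begin

text \<open>It suffices to find, for every point \<open>x\<close> and \<open>\<epsilon> > 0\<close>, a point \<open>y\<close> fixed by the whole group \<open>G\<close> with
  \<open>dist y x \<le> \<epsilon>\<close>, because the fixed points of isometries form a closed set. Such a \<open>y\<close> is produced as a
  weak limit point of a sequence \<open>g m \<cdot> x\<close>, where the \<open>g m \<in> G\<close> all move \<open>x\<close> by at most \<open>\<epsilon>\<close>. Reflexivity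
  enters only here: for a bounded sequence some point lies in the closed convex hull of each of its
  tails (\<open>reflexive_weak_limit_point\<close>, from a Hahn-Banach theorem proved below).

  In both groups continuity gives, for each \<open>e > 0\<close>, a finite set \<open>B\<close> whose pointwise stabilizer moves \<open>x\<close>
  by at most \<open>e\<close>; so \<open>h \<cdot> x\<close> is determined up to \<open>e\<close> by the restriction of \<open>h\<close> to \<open>B\<close>. Approximate \<open>y\<close> by
  two convex combinations of the \<open>g m \<cdot> x\<close>, one over \<open>m \<in> I\<close> and one over \<open>m \<in> J\<close>. If some
  \<open>k'' \<in> G\<close> agrees with \<open>k\<close> on the sets \<open>g m ` B\<close> for \<open>m \<in> I\<close> and with \<open>k'\<close> on those for \<open>m \<in> J\<close>, then
  passing from \<open>k\<close> to \<open>k''\<close> at the first combination and from \<open>k''\<close> to \<open>k'\<close> at the second shows that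
  \<open>k \<cdot> y\<close> and \<open>k' \<cdot> y\<close> differ by at most \<open>6 * e\<close> (\<open>limit_displacement_by_switching\<close>). Whether \<open>k''\<close> exists depends
  only on the order, respectively the metric, of finitely many points. It remains to choose the \<open>g m\<close> so that
  such switches connect the identity to every element of \<open>G\<close> in a number of steps not depending on \<open>e\<close>.

  For increasing homeomorphisms, cut \<open>[0, 1]\<close> into \<open>L\<close> short intervals and let \<open>g m\<close> fix the cutting points
  and push everything else towards the right ends of the intervals. A map \<open>k\<close> that moves
  no inner cutting point to the left, and none as far as the next one, can be exchanged with the identity when
  \<open>I\<close> is taken far out and \<open>J\<close> much further. Hence \<open>k \<cdot> y = y\<close>. Such maps generate \<open>G\<close>, by connectedness.

  For the Urysohn sphere, let the \<open>g m\<close> shift larger and larger finite sets so that the copies lie as generically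
  as possible at distance \<open>t\<close> from each other: the copies of \<open>b\<close> and \<open>c\<close> have distance \<open>min 1 (d b c + t)\<close>.
  If \<open>k\<close> and \<open>l\<close> differ by another such shift on the relevant finite set, a third isometry
  can be exchanged with both of them. About \<open>1 / t\<close> such steps separate a finite set from a copy at the maximal
  distance \<open>1\<close>, and any two copies of it have a common copy at distance \<open>1\<close> from both.\<close>

section \<open>The Hahn-Banach theorem\<close>

definition sublinear_functional :: "('v::real_vector \<Rightarrow> real) \<Rightarrow> bool" where
  "sublinear_functional p \<longleftrightarrow>
     (\<forall>x y. p (x + y) \<le> p x + p y) \<and> (\<forall>c x. c \<ge> 0 \<longrightarrow> p (c *\<^sub>R x) = c * p x)"

lemma sublinear_functionalI:
  assumes "\<And>x y. p (x + y) \<le> p x + p y"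
    and "\<And>c x. c > 0 \<Longrightarrow> p (c *\<^sub>R x) \<le> c * p x" and "p 0 = 0"
  shows "sublinear_functional p"
  unfolding sublinear_functional_def
proof (intro conjI allI impI)
  fix c x assume c: "(c::real) \<ge> 0"
  show "p (c *\<^sub>R x) = c * p x"
  proof (cases "c = 0")
    case False
    then have c: "c > 0" using c by simp
    have "p (inverse c *\<^sub>R c *\<^sub>R x) \<le> inverse c * p (c *\<^sub>R x)"
      using c by (intro assms) auto
    then have "c * p x \<le> p (c *\<^sub>R x)" using c by (simp add: field_simps)
    then show ?thesis using assms(2)[OF c, of x] by simp
  qed (simp add: assms)
qed (rule assms)

lemma sublinear_functional_zero: "sublinear_functional p \<Longrightarrow> p 0 = 0"
  unfolding sublinear_functional_def by (metis mult_zero_left order_refl scaleR_zero_left)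

lemma sublinear_functional_lower:
  assumes "sublinear_functional p" shows "- p (- x) \<le> p x"
proof -
  have "p (x + - x) \<le> p x + p (- x)" using assms unfolding sublinear_functional_def by blast
  then show ?thesis using sublinear_functional_zero[OF assms] by simp
qed

text \<open>Fix \<open>y\<close> and lower \<open>q\<close> to \<open>r x = (INF t. q (x + t y) - t q y)\<close>. This is again sublinear, so minimality gives
  \<open>q = r\<close>, and the value \<open>t = 1\<close> yields superadditivity.\<close>

lemma minimal_sublinear_imp_linear:
  assumes q: "sublinear_functional q"
    and min: "\<And>r. sublinear_functional r \<Longrightarrow> (\<And>x. r x \<le> q x) \<Longrightarrow> r = q"
  shows "linear q"
proof -
  have sub: "q (x + y) \<le> q x + q y" and hom: "c \<ge> 0 \<Longrightarrow> q (c *\<^sub>R x) = c * q x" for x y c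
    using q unfolding sublinear_functional_def by blast+
  have super: "q x + q y \<le> q (x + y)" for x y
  proof -
    define r where "r x = (INF t\<in>{0..}. q (x + t *\<^sub>R y) - t * q y)" for x
    have lb: "- q (- x) \<le> q (x + t *\<^sub>R y) - t * q y" if "t \<ge> 0" for x t
      using sub[of "x + t *\<^sub>R y" "- x"] hom[OF that, of y] by (simp add: algebra_simps)
    have bdd: "bdd_below ((\<lambda>t. q (x + t *\<^sub>R y) - t * q y) ` {0..})" for x
      by (rule bdd_belowI2[of _ "- q (- x)"]) (use lb in auto)
    have le: "r x \<le> q (x + t *\<^sub>R y) - t * q y" if "t \<ge> 0" for x t
      unfolding r_def by (rule cINF_lower[OF bdd]) (use that in auto)
    have ge: "m \<le> r x" if "\<And>t. t \<ge> 0 \<Longrightarrow> m \<le> q (x + t *\<^sub>R y) - t * q y" for m x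
      unfolding r_def by (rule cINF_greatest) (use that in auto)
    have "sublinear_functional r"
    proof (rule sublinear_functionalI)
      fix x z
      have *: "r (x + z) - (q (z + t *\<^sub>R y) - t * q y) \<le> r x" if t: "t \<ge> 0" for t
      proof (rule ge)
        fix s :: real assume s: "s \<ge> 0"
        have "r (x + z) \<le> q ((x + z) + (s + t) *\<^sub>R y) - (s + t) * q y"
          using s t by (intro le) auto
        moreover have "q ((x + z) + (s + t) *\<^sub>R y) \<le> q (x + s *\<^sub>R y) + q (z + t *\<^sub>R y)"
          using sub[of "x + s *\<^sub>R y" "z + t *\<^sub>R y"] by (simp add: algebra_simps)
        ultimately show "r (x + z) - (q (z + t *\<^sub>R y) - t * q y) \<le> q (x + s *\<^sub>R y) - s * q y"
          by (simp add: algebra_simps)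
      qed
      have "r (x + z) - r x \<le> r z"
        by (rule ge) (use * in \<open>simp add: algebra_simps\<close>)
      then show "r (x + z) \<le> r x + r z" by simp
    next
      fix c :: real and x assume c: "c > 0"
      have "r (c *\<^sub>R x) / c \<le> r x"
      proof (rule ge)
        fix t :: real assume t: "t \<ge> 0"
        have "r (c *\<^sub>R x) \<le> q (c *\<^sub>R x + (c * t) *\<^sub>R y) - (c * t) * q y"
          using c t by (intro le) auto
        also have "c *\<^sub>R x + (c * t) *\<^sub>R y = c *\<^sub>R (x + t *\<^sub>R y)" by (simp add: algebra_simps)
        also have "q \<dots> = c * q (x + t *\<^sub>R y)" using c by (intro hom) auto
        finally show "r (c *\<^sub>R x) / c \<le> q (x + t *\<^sub>R y) - t * q y"
          using c by (simp add: field_simps)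
      qed
      then show "r (c *\<^sub>R x) \<le> c * r x" using c by (simp add: field_simps)
    next
      have q0: "q 0 = 0" by (rule sublinear_functional_zero[OF q])
      have "r 0 \<le> 0" using le[of 0 0] q0 by simp
      moreover have "0 \<le> r 0" by (rule ge) (simp add: hom)
      ultimately show "r 0 = 0" by simp
    qed
    moreover have "r x \<le> q x" for x using le[of 0 x] by simp
    ultimately have "r = q" by (rule min)
    then show ?thesis using le[of 1 x] by simp
  qed
  have add: "q (x + y) = q x + q y" for x y using sub super by (simp add: antisym)
  have neg: "q (- x) = - q x" for x
    using add[of x "- x"] sublinear_functional_zero[OF q] by simp
  show ?thesis
  proof (rule linearI)
    fix c x
    show "q (c *\<^sub>R x) = c *\<^sub>R q x"
    proof (cases "c \<ge> 0")
      case False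
      then have "q ((- c) *\<^sub>R x) = - c * q x" by (intro hom) auto
      then show ?thesis using neg[of "c *\<^sub>R x"] by simp
    qed (simp add: hom)
  qed (rule add)
qed

text \<open>Pointwise infima of chains of sublinear functionals below \<open>p\<close> are finite, since
  \<open>- p (- x) \<le> q x\<close>, and sublinear. So Zorn's lemma gives a minimal sublinear functional below \<open>p\<close>.\<close>

theorem Hahn_Banach_sublinear:
  assumes p: "sublinear_functional p"
  obtains f where "linear f" "\<And>x. f x \<le> p x"
proof -
  define A where "A = {q. sublinear_functional q \<and> q \<le> p}"
  define P where "P = (\<lambda>q r :: 'a \<Rightarrow> real. r \<le> q)"
  have "\<exists>m\<in>A. \<forall>a\<in>A. P m a \<longrightarrow> a = m"
  proof (rule predicate_Zorn)
    show "partial_order_on A (relation_of P A)"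
      unfolding P_def by (rule partial_order_on_relation_ofI) auto
  next
    fix C assume "C \<in> Chains (relation_of P A)"
    then have CA: "C \<subseteq> A" and chain: "\<And>q r. q \<in> C \<Longrightarrow> r \<in> C \<Longrightarrow> q \<le> r \<or> r \<le> q"
      unfolding Chains_def relation_of_def P_def by auto
    show "\<exists>u\<in>A. \<forall>a\<in>C. P a u"
    proof (cases "C = {}")
      case True then show ?thesis using p by (auto simp: A_def)
    next
      case False
      define u where "u x = (INF q\<in>C. q x)" for x
      have sl: "sublinear_functional q" and qp: "q x \<le> p x" if "q \<in> C" for q x
        using that CA by (auto simp: A_def le_fun_def)
      have "- p (- x) \<le> q x" if "q \<in> C" for q x
        using sublinear_functional_lower[OF sl[OF that], of x] qp[OF that, of "- x"] by linarith
      then have bdd: "bdd_below ((\<lambda>q. q x) ` C)" for x by (intro bdd_belowI2[of _ "- p (- x)"])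
      have le: "u x \<le> q x" if "q \<in> C" for q x
        unfolding u_def by (rule cINF_lower[OF bdd that])
      have ge: "m \<le> u x" if "\<And>q. q \<in> C \<Longrightarrow> m \<le> q x" for m x
        unfolding u_def by (rule cINF_greatest[OF False that])
      have "sublinear_functional u"
      proof (rule sublinear_functionalI)
        fix x y
        have *: "u (x + y) \<le> q x + r y" if "q \<in> C" "r \<in> C" for q r
        proof -
          from that chain[of q r] obtain s where s: "s \<in> C" "s \<le> q" "s \<le> r" by blast
          have "u (x + y) \<le> s (x + y)" using le s by blast
          also have "\<dots> \<le> s x + s y" using sl[OF s(1)] unfolding sublinear_functional_def by blast
          also have "\<dots> \<le> q x + r y" using s by (simp add: le_fun_def add_mono)
          finally show ?thesis .
        qed
        have "u (x + y) - r y \<le> u x" if "r \<in> C" for r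
          by (rule ge) (use *[OF _ that] in \<open>simp add: algebra_simps\<close>)
        then have "u (x + y) - u x \<le> u y" by (intro ge) (simp add: algebra_simps)
        then show "u (x + y) \<le> u x + u y" by simp
      next
        fix c :: real and x assume c: "c > 0"
        have "u (c *\<^sub>R x) / c \<le> u x"
        proof (rule ge)
          fix q assume q: "q \<in> C"
          have "u (c *\<^sub>R x) \<le> q (c *\<^sub>R x)" using le q by blast
          also have "\<dots> = c * q x" using sl[OF q] c unfolding sublinear_functional_def by simp
          finally show "u (c *\<^sub>R x) / c \<le> q x" using c by (simp add: field_simps)
        qed
        then show "u (c *\<^sub>R x) \<le> c * u x" using c by (simp add: field_simps)
      next
        have "q 0 = 0" if "q \<in> C" for q by (rule sublinear_functional_zero[OF sl[OF that]])
        then have "(\<lambda>q. q 0) ` C = {0}" using False by force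
        then show "u 0 = 0" by (simp add: u_def)
      qed
      moreover have "u \<le> p"
      proof -
        obtain q where "q \<in> C" using False by blast
        then show ?thesis using le qp unfolding le_fun_def by (meson order_trans)
      qed
      ultimately show ?thesis using le by (auto simp: A_def P_def le_fun_def intro!: bexI[of _ u])
    qed
  qed
  then obtain m where m: "m \<in> A" "\<And>a. a \<in> A \<Longrightarrow> a \<le> m \<Longrightarrow> a = m" unfolding P_def by blast
  have "linear m"
  proof (rule minimal_sublinear_imp_linear)
    show "sublinear_functional m" using m by (simp add: A_def)
    fix r assume "sublinear_functional r" "\<And>x. r x \<le> m x"
    then show "r = m" using m(1) by (intro m(2)) (auto simp: A_def le_fun_def intro: order_trans)
  qed
  then show ?thesis using that m(1) by (auto simp: A_def le_fun_def)
qed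

section \<open>Weak limit points in reflexive spaces\<close>

text \<open>A functional dominated by
  \<open>p z = inf {norm (z + t (k - y)) - t \<delta> | t \<ge> 0, k \<in> K}\<close> is bounded by the norm (take \<open>t = 0\<close>) and has the required
  values on \<open>k - y\<close> (take \<open>z = y - k\<close> and \<open>t = 1\<close>). The distance assumption is what keeps \<open>p\<close> finite, and
  convexity of \<open>K\<close> makes it subadditive.\<close>

lemma separate_point_from_convex:
  fixes K :: "'e::real_normed_vector set"
  assumes K: "convex K" "K \<noteq> {}" and far: "\<And>k. k \<in> K \<Longrightarrow> \<delta> \<le> norm (k - y)"
  obtains f :: "'e \<Rightarrow>\<^sub>L real" where "\<And>k. k \<in> K \<Longrightarrow> blinfun_apply f (k - y) \<ge> \<delta>"
proof -
  define S where "S = {0::real..} \<times> K"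
  define v where "v z tk = norm (z + fst tk *\<^sub>R (snd tk - y)) - fst tk * \<delta>" for z tk
  define p where "p z = (INF tk\<in>S. v z tk)" for z
  have ne: "S \<noteq> {}" using K by (auto simp: S_def)
  have lb: "- norm z \<le> v z tk" if "tk \<in> S" for z tk
  proof -
    have "fst tk * \<delta> \<le> fst tk * norm (snd tk - y)"
      using that far by (intro mult_left_mono) (auto simp: S_def)
    also have "\<dots> = norm (fst tk *\<^sub>R (snd tk - y))" using that by (auto simp: S_def)
    also have "\<dots> \<le> norm (z + fst tk *\<^sub>R (snd tk - y)) + norm z"
      using norm_triangle_ineq4[of "z + fst tk *\<^sub>R (snd tk - y)" z] by simp
    finally show ?thesis by (simp add: v_def)
  qed
  have bdd: "bdd_below (v z ` S)" for z by (rule bdd_belowI2[of _ "- norm z"]) (use lb in auto)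
  have le: "p z \<le> v z tk" if "tk \<in> S" for z tk unfolding p_def by (rule cINF_lower[OF bdd that])
  have ge: "m \<le> p z" if "\<And>tk. tk \<in> S \<Longrightarrow> m \<le> v z tk" for m z
    unfolding p_def by (rule cINF_greatest[OF ne that])
  have p_le_norm: "p z \<le> norm z" for z
  proof -
    obtain k where "k \<in> K" using K by blast
    then show ?thesis using le[of "(0, k)" z] by (simp add: S_def v_def)
  qed
  have "sublinear_functional p"
  proof (rule sublinear_functionalI)
    fix x z
    have *: "p (x + z) \<le> v x a + v z b" if ab: "a \<in> S" "b \<in> S" for a b
    proof -
      obtain s k t l where a: "a = (s, k)" "s \<ge> 0" "k \<in> K" and b: "b = (t, l)" "t \<ge> 0" "l \<in> K"
        using ab by (auto simp: S_def)
      show ?thesis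
      proof (cases "s + t = 0")
        case True
        then have "s = 0" "t = 0" using a b by auto
        then show ?thesis using p_le_norm[of "x + z"] norm_triangle_ineq[of x z] a b
          by (simp add: v_def)
      next
        case False
        then have pos: "s + t > 0" using a b by auto
        \<comment> \<open>The weighted mean turns \<open>s (k - y) + t (l - y)\<close> into \<open>(s + t) (m - y)\<close>.\<close>
        define m where "m = (s / (s + t)) *\<^sub>R k + (t / (s + t)) *\<^sub>R l"
        have "m \<in> K" unfolding m_def using a b pos
          by (intro convexD[OF K(1)]) (auto simp: add_divide_distrib[symmetric])
        then have "p (x + z) \<le> v (x + z) (s + t, m)" using a b by (intro le) (auto simp: S_def)
        also have "(s + t) *\<^sub>R m = s *\<^sub>R k + t *\<^sub>R l" using pos by (simp add: m_def scaleR_right_distrib)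
        then have "(x + z) + (s + t) *\<^sub>R (m - y) = (x + s *\<^sub>R (k - y)) + (z + t *\<^sub>R (l - y))"
          by (simp add: algebra_simps)
        then have "v (x + z) (s + t, m) \<le> v x a + v z b"
          using norm_triangle_ineq[of "x + s *\<^sub>R (k - y)" "z + t *\<^sub>R (l - y)"]
          by (simp add: v_def a b algebra_simps)
        finally show ?thesis .
      qed
    qed
    have "p (x + z) - v z b \<le> p x" if "b \<in> S" for b
      by (rule ge) (use *[OF _ that] in \<open>simp add: algebra_simps\<close>)
    then have "p (x + z) - p x \<le> p z" by (intro ge) (simp add: algebra_simps)
    then show "p (x + z) \<le> p x + p z" by simp
  next
    fix c :: real and x assume c: "c > 0"
    have "p (c *\<^sub>R x) / c \<le> p x"
    proof (rule ge)
      fix tk assume tk: "tk \<in> S"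
      have "p (c *\<^sub>R x) \<le> v (c *\<^sub>R x) (c * fst tk, snd tk)"
        using c tk by (intro le) (auto simp: S_def)
      also have "\<dots> = norm (c *\<^sub>R (x + fst tk *\<^sub>R (snd tk - y))) - c * (fst tk * \<delta>)"
        by (simp add: v_def algebra_simps)
      also have "\<dots> = c * v x tk"
        using c unfolding norm_scaleR v_def by (simp add: right_diff_distrib)
      finally show "p (c *\<^sub>R x) / c \<le> v x tk" using c by (simp add: field_simps)
    qed
    then show "p (c *\<^sub>R x) \<le> c * p x" using c by (simp add: field_simps)
  next
    have "0 \<le> p 0" by (rule ge) (use lb[of _ 0] in auto)
    then show "p 0 = 0" using p_le_norm[of 0] by simp
  qed
  then obtain f where f: "linear f" "\<And>x. f x \<le> p x" by (rule Hahn_Banach_sublinear) auto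
  have abs_le: "\<bar>f x\<bar> \<le> norm x" for x
    using f(2)[of x] f(2)[of "- x"] p_le_norm[of x] p_le_norm[of "- x"] linear_neg[OF f(1), of x]
    by simp
  have bl: "bounded_linear f"
    by (rule bounded_linear_intro[where K = 1])
       (use f(1) abs_le in \<open>auto simp: linear_add linear_scale\<close>)
  have "blinfun_apply (Blinfun f) (k - y) \<ge> \<delta>" if k: "k \<in> K" for k
  proof -
    have "f (- (k - y)) \<le> v (- (k - y)) (1, k)"
      using f(2) le[of "(1, k)" "- (k - y)"] k by (auto simp: S_def intro: order_trans)
    also have "\<dots> = - \<delta>" by (simp add: v_def)
    finally show ?thesis using linear_neg[OF f(1), of "k - y"] bl
      by (simp add: bounded_linear_Blinfun_apply)
  qed
  then show ?thesis by (rule that)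
qed

text \<open>The functional \<open>\<phi> \<mapsto> limsup \<phi> (z m)\<close> on the dual space is sublinear, so it dominates an element of
  the bidual, which by reflexivity is evaluation at some \<open>y\<close>. Separating \<open>y\<close> from the convex hull of a tail by
  a functional \<open>\<phi>\<close> would contradict \<open>- \<phi> y \<le> limsup (- \<phi> (z m))\<close>. This replaces weak compactness of balls.\<close>

lemma reflexive_weak_limit_point:
  fixes z :: "nat \<Rightarrow> 'e::real_normed_vector"
  assumes refl: "reflexive_space TYPE('e)" and bdd: "\<And>m. norm (z m) \<le> C"
  obtains y where "\<And>n. y \<in> closure (convex hull (z ` {n..}))"
proof -
  define p where "p \<phi> = Inf {c. eventually (\<lambda>m. blinfun_apply \<phi> (z m) \<le> c) sequentially}"
    for \<phi> :: "'e \<Rightarrow>\<^sub>L real"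
  let ?E = "\<lambda>\<phi>. {c. eventually (\<lambda>m. blinfun_apply \<phi> (z m) \<le> c) sequentially}"
  have ab: "\<bar>blinfun_apply \<phi> (z m)\<bar> \<le> norm \<phi> * C" for \<phi> :: "'e \<Rightarrow>\<^sub>L real" and m
    using norm_blinfun[of \<phi> "z m"] mult_left_mono[OF bdd[of m], of "norm \<phi>"] by simp
  have lbE: "- (norm \<phi> * C) \<le> c" if "c \<in> ?E \<phi>" for \<phi> c
  proof -
    obtain m where "blinfun_apply \<phi> (z m) \<le> c"
      using eventually_happens[of _ sequentially] \<open>c \<in> ?E \<phi>\<close> by auto
    then show ?thesis using ab[of \<phi> m] by linarith
  qed
  have inE: "norm \<phi> * C \<in> ?E \<phi>" for \<phi> using ab[of \<phi>] by (auto simp: abs_le_iff)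
  have le: "p \<phi> \<le> c" if "eventually (\<lambda>m. blinfun_apply \<phi> (z m) \<le> c) sequentially" for \<phi> c
    unfolding p_def by (rule cInf_lower) (use that lbE in \<open>auto intro!: bdd_belowI\<close>)
  have gt: "eventually (\<lambda>m. blinfun_apply \<phi> (z m) \<le> c) sequentially" if "p \<phi> < c" for \<phi> c
  proof -
    have "?E \<phi> \<noteq> {}" using inE by blast
    from cInf_lessD[OF this that[unfolded p_def]] obtain c' where c': "c' \<in> ?E \<phi>" "c' < c" by blast
    from c'(1) have "eventually (\<lambda>m. blinfun_apply \<phi> (z m) \<le> c') sequentially" by simp
    then show ?thesis by (rule eventually_mono) (use c'(2) in linarith)
  qed
  have p_bound: "p \<phi> \<le> norm \<phi> * C" for \<phi> using inE by (intro le) auto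
  have "sublinear_functional p"
  proof (rule sublinear_functionalI)
    fix \<phi> \<psi>
    show "p (\<phi> + \<psi>) \<le> p \<phi> + p \<psi>"
    proof (rule field_le_epsilon)
      fix e :: real assume e: "e > 0"
      have "eventually (\<lambda>m. blinfun_apply \<phi> (z m) \<le> p \<phi> + e / 2) sequentially"
        "eventually (\<lambda>m. blinfun_apply \<psi> (z m) \<le> p \<psi> + e / 2) sequentially"
        using e by (auto intro: gt)
      then have "eventually (\<lambda>m. blinfun_apply (\<phi> + \<psi>) (z m) \<le> p \<phi> + p \<psi> + e) sequentially"
        by eventually_elim (simp add: blinfun.add_left)
      then show "p (\<phi> + \<psi>) \<le> p \<phi> + p \<psi> + e" by (rule le)
    qed
  next
    fix c :: real and \<phi> assume c: "c > 0"
    show "p (c *\<^sub>R \<phi>) \<le> c * p \<phi>"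
    proof (rule field_le_epsilon)
      fix e :: real assume e: "e > 0"
      have "eventually (\<lambda>m. blinfun_apply \<phi> (z m) \<le> p \<phi> + e / c) sequentially"
        using e c by (auto intro: gt)
      then have "eventually (\<lambda>m. blinfun_apply (c *\<^sub>R \<phi>) (z m) \<le> c * p \<phi> + e) sequentially"
        by eventually_elim (use c in \<open>simp add: blinfun.scaleR_left field_simps\<close>)
      then show "p (c *\<^sub>R \<phi>) \<le> c * p \<phi> + e" by (rule le)
    qed
  next
    have "p 0 \<le> 0" by (rule le) simp
    moreover have "0 \<le> p 0" unfolding p_def
      by (rule cInf_greatest) (use inE lbE[of _ 0] in force)+
    ultimately show "p 0 = 0" by simp
  qed
  then obtain f where f: "linear f" "\<And>\<phi>. f \<phi> \<le> p \<phi>" by (rule Hahn_Banach_sublinear) auto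
  have abs_le: "\<bar>f \<phi>\<bar> \<le> norm \<phi> * C" for \<phi>
    using f(2)[of \<phi>] f(2)[of "- \<phi>"] p_bound[of \<phi>] p_bound[of "- \<phi>"] linear_neg[OF f(1), of \<phi>]
    by simp
  have bl: "bounded_linear f"
    by (rule bounded_linear_intro[where K = C])
       (use f(1) abs_le in \<open>auto simp: linear_add linear_scale\<close>)
  obtain y :: 'e where y: "bidual_embedding y = Blinfun f"
    using refl unfolding reflexive_space_def by (metis surj_def)
  have fy: "blinfun_apply \<phi> y = f \<phi>" for \<phi>
    using bidual_embedding_apply[of y \<phi>] y bl by (simp add: bounded_linear_Blinfun_apply)
  have "y \<in> closure (convex hull (z ` {n..}))" for n
  proof (rule ccontr)
    let ?K = "convex hull (z ` {n..})"
    assume "y \<notin> closure ?K"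
    then obtain \<delta> where \<delta>: "\<delta> > 0" "\<And>k. k \<in> ?K \<Longrightarrow> \<delta> \<le> dist k y"
      unfolding closure_approachable by (meson not_less)
    obtain \<phi> :: "'e \<Rightarrow>\<^sub>L real" where \<phi>: "\<And>k. k \<in> ?K \<Longrightarrow> blinfun_apply \<phi> (k - y) \<ge> \<delta>"
      by (rule separate_point_from_convex[of ?K \<delta> y]) (use \<delta> in \<open>auto simp: dist_norm\<close>)
    have "eventually (\<lambda>m. blinfun_apply (- \<phi>) (z m) \<le> - blinfun_apply \<phi> y - \<delta>) sequentially"
      using eventually_ge_at_top[of n]
    proof eventually_elim
      case (elim m)
      then have "z m \<in> ?K" by (intro hull_inc) auto
      then show ?case using \<phi>[of "z m"] by (simp add: blinfun.diff_right blinfun.minus_left)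
    qed
    then have "p (- \<phi>) \<le> - blinfun_apply \<phi> y - \<delta>" by (rule le)
    moreover have "- blinfun_apply \<phi> y \<le> p (- \<phi>)"
      using f(2)[of "- \<phi>"] fy[of "- \<phi>"] by (simp add: blinfun.minus_left)
    ultimately show False using \<delta> by simp
  qed
  then show ?thesis by (rule that)
qed

section \<open>Groups of bijections acting by affine isometries\<close>

text \<open>Both groups consist of extensional bijections of a set \<open>S\<close> under composition, which allows the part of the
  argument that only concerns restrictions to finite subsets of \<open>S\<close> to be carried out once.\<close>

locale bijection_group_action =
  fixes S :: "'s set" and H :: "('s \<Rightarrow> 's) set" and \<alpha> :: "('s \<Rightarrow> 's) \<Rightarrow> 'e::banach \<Rightarrow> 'e"
  assumes group: "group ((BijGroup S)\<lparr>carrier := H\<rparr>)"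
    and H_Bij: "H \<subseteq> Bij S"
    and hom: "\<alpha> \<in> hom ((BijGroup S)\<lparr>carrier := H\<rparr>) AffIso_group"
    and reflexive: "reflexive_space TYPE('e)"
begin

lemma mult_eq: "f \<in> H \<Longrightarrow> g \<in> H \<Longrightarrow> f \<otimes>\<^bsub>(BijGroup S)\<lparr>carrier := H\<rparr>\<^esub> g = compose S f g"
  using H_Bij by (auto simp: BijGroup_def subset_iff)

lemma id_in_H: "(\<lambda>x\<in>S. x) \<in> H"
  using monoid.one_closed[OF group.is_monoid[OF group]] by (simp add: BijGroup_def)

lemma compose_in_H: "f \<in> H \<Longrightarrow> g \<in> H \<Longrightarrow> compose S f g \<in> H"
  using monoid.m_closed[OF group.is_monoid[OF group], of f g] mult_eq by simp

lemma maps_into: "f \<in> H \<Longrightarrow> x \<in> S \<Longrightarrow> f x \<in> S"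
  using H_Bij Bij_imp_funcset[of f S] by auto

lemma ext_H: "f \<in> H \<Longrightarrow> g \<in> H \<Longrightarrow> (\<And>x. x \<in> S \<Longrightarrow> f x = g x) \<Longrightarrow> f = g"
  using H_Bij by (meson Bij_imp_extensional extensionalityI subsetD)

lemma inverse_in_H:
  assumes "f \<in> H"
  obtains f' where "f' \<in> H" "\<And>x. x \<in> S \<Longrightarrow> f' (f x) = x" "\<And>x. x \<in> S \<Longrightarrow> f (f' x) = x"
proof -
  interpret G: group "(BijGroup S)\<lparr>carrier := H\<rparr>" by (rule group)
  let ?f' = "inv\<^bsub>(BijGroup S)\<lparr>carrier := H\<rparr>\<^esub> f"
  have f': "?f' \<in> H" using G.inv_closed[of f] assms by simp
  have "compose S ?f' f = (\<lambda>x\<in>S. x)" "compose S f ?f' = (\<lambda>x\<in>S. x)"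
    using G.l_inv[of f] G.r_inv[of f] mult_eq f' assms by (auto simp: BijGroup_def)
  then have "?f' (f x) = x" "f (?f' x) = x" if "x \<in> S" for x
    using that by (metis compose_eq restrict_apply')+
  then show ?thesis using that f' by blast
qed

lemma act_isometric_affine: "f \<in> H \<Longrightarrow> affine_map (\<alpha> f) \<and> (\<forall>x y. dist (\<alpha> f x) (\<alpha> f y) = dist x y)"
  using hom by (auto simp: hom_def AffIso_group_def)

lemma act_dist: "f \<in> H \<Longrightarrow> dist (\<alpha> f x) (\<alpha> f y) = dist x y"
  using act_isometric_affine by blast

lemma act_compose: "f \<in> H \<Longrightarrow> g \<in> H \<Longrightarrow> \<alpha> (compose S f g) x = \<alpha> f (\<alpha> g x)"
proof -
  assume fg: "f \<in> H" "g \<in> H"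
  have af: "\<alpha> h \<in> carrier AffIso_group" if "h \<in> H" for h
    using hom that by (auto simp: hom_def)
  then have bij: "\<alpha> h \<in> Bij UNIV" if "h \<in> H" for h
  proof -
    have "inj (\<alpha> h)" by (rule injI) (metis act_dist[OF that] dist_eq_0_iff)
    moreover have "surj (\<alpha> h)" using af[OF that] by (simp add: AffIso_group_def)
    ultimately show ?thesis by (simp add: Bij_def bij_def)
  qed
  have "\<alpha> (compose S f g) = \<alpha> f \<otimes>\<^bsub>AffIso_group\<^esub> \<alpha> g"
    using hom fg mult_eq by (simp add: hom_def)
  also have "\<dots> = compose UNIV (\<alpha> f) (\<alpha> g)"
    using bij fg by (simp add: AffIso_group_def BijGroup_def)
  finally show ?thesis by (simp add: compose_def)
qed

lemma act_id: "\<alpha> (\<lambda>x\<in>S. x) x = x"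
proof -
  let ?e = "\<lambda>x\<in>S. x"
  have "compose S ?e ?e = ?e" by (auto simp: compose_def fun_eq_iff)
  then have "dist (\<alpha> ?e (\<alpha> ?e x)) (\<alpha> ?e x) = 0"
    using act_compose[OF id_in_H id_in_H, of x] by simp
  then show ?thesis using act_dist[OF id_in_H, of "\<alpha> ?e x" x] by simp
qed

text \<open>If \<open>f\<close> and \<open>g\<close> agree on \<open>B\<close>, the inverse of \<open>g\<close> composed with \<open>f\<close> fixes \<open>B\<close> pointwise.\<close>

lemma act_close_of_agree:
  assumes "B \<subseteq> S" "f \<in> H" "g \<in> H" "\<And>b. b \<in> B \<Longrightarrow> f b = g b"
    and stab: "\<And>u. u \<in> H \<Longrightarrow> (\<And>b. b \<in> B \<Longrightarrow> u b = b) \<Longrightarrow> dist (\<alpha> u x) x \<le> e"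
  shows "dist (\<alpha> f x) (\<alpha> g x) \<le> e"
proof -
  obtain g' where g': "g' \<in> H" "\<And>x. x \<in> S \<Longrightarrow> g' (g x) = x" "\<And>x. x \<in> S \<Longrightarrow> g (g' x) = x"
    using inverse_in_H[OF assms(3)] by blast
  let ?u = "compose S g' f"
  have u: "?u \<in> H" using g' assms by (intro compose_in_H) auto
  have "compose S g ?u = f"
    by (rule ext_H) (use u g' assms maps_into in \<open>auto simp: compose_eq intro: compose_in_H\<close>)
  then have "\<alpha> f x = \<alpha> g (\<alpha> ?u x)" using act_compose[OF assms(3) u] by metis
  then have "dist (\<alpha> f x) (\<alpha> g x) = dist (\<alpha> ?u x) x" using act_dist assms by simp
  also have "\<dots> \<le> e" by (rule stab[OF u]) (use assms g' in \<open>auto simp: compose_eq subset_iff\<close>)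
  finally show ?thesis .
qed

text \<open>The difference of two affine maps is affine, so the points where they are \<open>e\<close>-close form a convex set.\<close>

lemma act_close_on_convex_hull:
  assumes k: "k \<in> H" "k' \<in> H" and "w \<in> convex hull Z"
    and close: "\<And>z. z \<in> Z \<Longrightarrow> dist (\<alpha> k z) (\<alpha> k' z) \<le> e"
  shows "dist (\<alpha> k w) (\<alpha> k' w) \<le> e"
proof -
  obtain L b L' b' where L: "linear L" "\<alpha> k = (\<lambda>x. L x + b)" "linear L'" "\<alpha> k' = (\<lambda>x. L' x + b')"
    using act_isometric_affine k unfolding affine_map_def by meson
  have lin: "linear (\<lambda>x. L x - L' x)" using L by (intro linear_compose_sub)
  have "{x. dist (\<alpha> k x) (\<alpha> k' x) \<le> e} = (\<lambda>x. L x - L' x) -` cball (b' - b) e"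
    by (auto simp: L dist_norm norm_minus_commute algebra_simps)
  then have "convex {x. dist (\<alpha> k x) (\<alpha> k' x) \<le> e}"
    using convex_linear_vimage[OF lin convex_cball] by metis
  then have "convex hull Z \<subseteq> {x. dist (\<alpha> k x) (\<alpha> k' x) \<le> e}"
    using close by (intro hull_minimal) auto
  then show ?thesis using assms by blast
qed

lemma orbit_limit_point:
  fixes g :: "nat \<Rightarrow> 's \<Rightarrow> 's"
  assumes near: "\<And>m. dist (\<alpha> (g m) x) x \<le> \<epsilon>"
  obtains y where "dist y x \<le> \<epsilon>"
    and "\<And>\<delta> n. \<delta> > 0 \<Longrightarrow> \<exists>I w. finite I \<and> I \<subseteq> {n..} \<and>
           w \<in> convex hull ((\<lambda>m. \<alpha> (g m) x) ` I) \<and> dist w y \<le> \<delta>"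
proof -
  let ?z = "\<lambda>m. \<alpha> (g m) x"
  have bound: "norm (?z m) \<le> norm x + \<epsilon>" for m
    using near[of m] norm_triangle_ineq2[of "?z m" x] by (simp add: dist_norm)
  obtain y where y: "\<And>n. y \<in> closure (convex hull (?z ` {n..}))"
    by (rule reflexive_weak_limit_point[of ?z, OF reflexive bound]) (rule that)
  have "closure (convex hull (?z ` {0..})) \<subseteq> cball x \<epsilon>"
    by (intro closure_minimal hull_minimal) (use near in \<open>auto simp: dist_commute\<close>)
  then have "dist y x \<le> \<epsilon>" using y[of 0] by (auto simp: dist_commute)
  moreover have "\<exists>I w. finite I \<and> I \<subseteq> {n..} \<and> w \<in> convex hull (?z ` I) \<and> dist w y \<le> \<delta>"
    if "\<delta> > 0" for \<delta> n
  proof -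
    obtain w where w: "w \<in> convex hull (?z ` {n..})" "dist w y < \<delta>"
      using y[of n] \<open>\<delta> > 0\<close> unfolding closure_approachable by blast
    obtain F u where F: "finite F" "F \<subseteq> ?z ` {n..}" "\<forall>v\<in>F. 0 \<le> u v" "sum u F = 1"
        "(\<Sum>v\<in>F. u v *\<^sub>R v) = w"
      using w(1) unfolding convex_hull_explicit by auto
    obtain I where I: "I \<subseteq> {n..}" "finite I" "F = ?z ` I"
      using finite_subset_image[OF F(1,2)] by blast
    have "w \<in> convex hull F" unfolding convex_hull_explicit using F by blast
    then show ?thesis using I w by (intro exI[of _ I] exI[of _ w]) auto
  qed
  ultimately show ?thesis by (rule that)
qed

text \<open>The chain behind the bound is \<open>k y\<close>, \<open>k v\<close>, \<open>k'' v\<close>, \<open>k'' y\<close>, \<open>k'' w\<close>, \<open>k' w\<close>, \<open>k' y\<close>, in which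
  neighbours are at distance at most \<open>e\<close>.\<close>

lemma limit_displacement_by_switching:
  assumes "B \<subseteq> S" and g: "\<And>m. g m \<in> H"
    and stab: "\<And>u. u \<in> H \<Longrightarrow> (\<And>b. b \<in> B \<Longrightarrow> u b = b) \<Longrightarrow> dist (\<alpha> u x) x \<le> e"
    and v: "v \<in> convex hull ((\<lambda>m. \<alpha> (g m) x) ` I)" "dist v y \<le> e"
    and w: "w \<in> convex hull ((\<lambda>m. \<alpha> (g m) x) ` J)" "dist w y \<le> e"
    and k: "k \<in> H" "k' \<in> H" "k'' \<in> H"
    and kI: "\<And>m b. m \<in> I \<Longrightarrow> b \<in> B \<Longrightarrow> k'' (g m b) = k (g m b)"
    and kJ: "\<And>m b. m \<in> J \<Longrightarrow> b \<in> B \<Longrightarrow> k'' (g m b) = k' (g m b)"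
  shows "dist (\<alpha> k y) (\<alpha> k' y) \<le> 6 * e"
proof -
  have agree: "dist (\<alpha> p (\<alpha> (g m) x)) (\<alpha> q (\<alpha> (g m) x)) \<le> e"
    if "p \<in> H" "q \<in> H" "\<And>b. b \<in> B \<Longrightarrow> p (g m b) = q (g m b)" for p q m
    using act_close_of_agree[OF assms(1) compose_in_H[OF that(1) g] compose_in_H[OF that(2) g] _ stab]
      that assms(1) by (simp add: act_compose g compose_eq subset_iff)
  have 1: "dist (\<alpha> k v) (\<alpha> k'' v) \<le> e"
    by (rule act_close_on_convex_hull[OF k(1,3) v(1)]) (use k kI agree in auto)
  have 2: "dist (\<alpha> k'' w) (\<alpha> k' w) \<le> e"
    by (rule act_close_on_convex_hull[OF k(3,2) w(1)]) (use k kJ agree in auto)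
  have "dist (\<alpha> h v) (\<alpha> h y) \<le> e" "dist (\<alpha> h w) (\<alpha> h y) \<le> e" if "h \<in> H" for h
    using v w act_dist that by auto
  note * = this
  show ?thesis
    using 1 2 *[OF k(1)] *[OF k(2)] *[OF k(3)]
      dist_triangle[of "\<alpha> k y" "\<alpha> k' y" "\<alpha> k v"] dist_triangle[of "\<alpha> k v" "\<alpha> k' y" "\<alpha> k'' v"]
      dist_triangle[of "\<alpha> k'' v" "\<alpha> k' y" "\<alpha> k'' y"] dist_triangle[of "\<alpha> k'' y" "\<alpha> k' y" "\<alpha> k'' w"]
      dist_triangle[of "\<alpha> k'' w" "\<alpha> k' y" "\<alpha> k' w"]
    by (simp add: dist_commute)
qed

lemma trivial_of_approximately_fixed:
  assumes "\<And>x \<epsilon>. \<epsilon> > 0 \<Longrightarrow> \<exists>y. dist y x \<le> \<epsilon> \<and> (\<forall>h\<in>H. \<alpha> h y = y)"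
  shows "trivial_action ((BijGroup S)\<lparr>carrier := H\<rparr>) \<alpha>"
proof -
  have "\<alpha> h x = x" if h: "h \<in> H" for h x
  proof -
    have "dist (\<alpha> h x) x \<le> 0 + e" if "e > 0" for e
    proof -
      obtain y where y: "dist y x \<le> e / 2" "\<alpha> h y = y" using assms[of "e / 2" x] \<open>e > 0\<close> h by auto
      then have "dist (\<alpha> h x) y = dist x y" using act_dist[OF h, of x y] by simp
      then show ?thesis using dist_triangle[of "\<alpha> h x" x y] y by (simp add: dist_commute)
    qed
    then have "dist (\<alpha> h x) x \<le> 0" by (rule field_le_epsilon)
    then show ?thesis by simp
  qed
  then show ?thesis by (simp add: trivial_action_def)
qed

lemma identity_neighbourhood:
  assumes "continuous_map (prod_topology T euclidean) euclidean (\<lambda>(g, x). \<alpha> g x)"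
    and T: "topspace T = H" and "\<epsilon> > 0"
  obtains U where "openin T U" "(\<lambda>x\<in>S. x) \<in> U" "\<And>h. h \<in> U \<Longrightarrow> dist (\<alpha> h x) x < \<epsilon>"
proof -
  have "continuous_map T (prod_topology T euclidean) (\<lambda>g. (g, x))"
    by (auto simp: continuous_map_pairwise o_def)
  from continuous_map_compose[OF this assms(1)]
  have "continuous_map T euclidean (\<lambda>g. \<alpha> g x)" by (simp add: o_def)
  then have "openin T {h \<in> topspace T. \<alpha> h x \<in> ball x \<epsilon>}"
    by (rule openin_continuous_map_preimage) simp
  then show ?thesis by (rule that) (use id_in_H T act_id \<open>\<epsilon> > 0\<close> in \<open>auto simp: dist_commute\<close>)
qed

end

section \<open>Increasing homeomorphisms of the unit interval\<close>

lemma Homeo_plus_I_D: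
  assumes "f \<in> carrier Homeo_plus_I"
  shows "f \<in> Bij {0..1}" "continuous_on {0..1} f" "f 0 = 0" "f 1 = 1"
    "\<And>x. x \<in> {0..1} \<Longrightarrow> f x \<in> {0..1}"
  using assms Bij_imp_funcset[of f "{0..1}"]
  by (auto simp: Homeo_plus_I_def homeomorphism_def Pi_iff)

lemma Homeo_plus_I_strict_mono:
  assumes f: "f \<in> carrier Homeo_plus_I" and xy: "0 \<le> x" "x < y" "y \<le> 1"
  shows "f x < f y"
proof -
  note D = Homeo_plus_I_D[OF f]
  have inj: "inj_on f {0..1}" using D(1) by (simp add: Bij_def bij_betw_def)
  have y: "0 < f y"
  proof (cases "y = 1")
    case False
    then show ?thesis
      using continuous_inj_imp_mono[of 0 y 1 f] xy D inj by auto
  qed (use D in simp)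
  show ?thesis
  proof (cases "x = 0")
    case False
    have "continuous_on {0..y} f" "inj_on f {0..y}"
      using D(2) inj xy by (auto intro: continuous_on_subset inj_on_subset)
    then show ?thesis
      using continuous_inj_imp_mono[of 0 x y f] xy False D y by auto
  qed (use y D in simp)
qed

lemma Homeo_plus_I_mono:
  assumes "f \<in> carrier Homeo_plus_I" "0 \<le> x" "x \<le> y" "y \<le> 1"
  shows "f x \<le> f y"
  using Homeo_plus_I_strict_mono[of f x y] assms by (cases "x = y") auto

lemma Homeo_plus_I_open_interval:
  assumes "f \<in> carrier Homeo_plus_I" "0 < x" "x < 1"
  shows "0 < f x" "f x < 1"
  using Homeo_plus_I_strict_mono[OF assms(1), of 0 x] Homeo_plus_I_strict_mono[OF assms(1), of x 1]
    Homeo_plus_I_D[OF assms(1)] assms by auto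

lemma Homeo_plus_I_I:
  fixes f :: "real \<Rightarrow> real"
  assumes cont: "continuous_on {0..1} f" and mono: "\<And>x y. 0 \<le> x \<Longrightarrow> x < y \<Longrightarrow> y \<le> 1 \<Longrightarrow> f x < f y"
    and f01: "f 0 = 0" "f 1 = 1"
  shows "(\<lambda>x\<in>{0..1}. f x) \<in> carrier Homeo_plus_I"
proof -
  let ?g = "\<lambda>x\<in>{0..1}. f x"
  have inj: "inj_on f {0..1}"
    by (rule inj_onI) (metis atLeastAtMost_iff linorder_neqE less_irrefl mono)
  have "f x \<in> {0..1}" if "x \<in> {0..1}" for x
    using mono[of 0 x] mono[of x 1] that f01 by (cases "x = 0"; cases "x = 1") auto
  moreover have "y \<in> f ` {0..1}" if "y \<in> {0..1}" for y
    using IVT'[of f 0 y 1] that f01 cont by auto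
  ultimately have im: "f ` {0..1} = {0..1}" by blast
  have cg: "continuous_on {0..1} ?g" 
    using cont by (rule continuous_on_eq) simp
  have ig: "?g ` {0..1} = {0..1}" using im by (metis image_restrict_eq)
  have jg: "inj_on ?g {0..1}" using inj by (simp add: inj_on_restrict_eq)
  have "\<exists>h. homeomorphism {0..1} {0..1} ?g h"
    using homeomorphism_compact[OF _ cg ig jg] by auto
  moreover have "?g \<in> Bij {0..1}" using ig jg by (simp add: Bij_def bij_betw_def)
  ultimately show ?thesis using f01 by (simp add: Homeo_plus_I_def)
qed

lemma compose_Homeo_plus_I:
  assumes "f \<in> carrier Homeo_plus_I" "g \<in> carrier Homeo_plus_I"
  shows "compose {0..1} f g \<in> carrier Homeo_plus_I"
proof -
  interpret group Homeo_plus_I by (rule group_Homeo_plus_I)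
  have "f \<otimes>\<^bsub>Homeo_plus_I\<^esub> g = compose {0..1} f g"
    using Homeo_plus_I_D(1)[OF assms(1)] Homeo_plus_I_D(1)[OF assms(2)]
    by (simp add: Homeo_plus_I_def BijGroup_def)
  then show ?thesis using m_closed[OF assms] by simp
qed

lemma Homeo_plus_I_bump:
  fixes s u v :: real
  assumes "0 \<le> s" "s < u" "u < 1" "s < v" "v < 1"
  obtains j where "j \<in> carrier Homeo_plus_I" "\<And>x. 0 \<le> x \<Longrightarrow> x \<le> s \<Longrightarrow> j x = x" "j u = v"
proof -
  define a where "a = (v - s) / (u - s)"
  define b where "b = (1 - v) / (1 - u)"
  have ab: "a > 0" "b > 0" using assms by (auto simp: a_def b_def)
  have au: "s + a * (u - s) = v" using assms by (simp add: a_def)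
  have b1: "v + b * (1 - u) = 1" using assms by (simp add: b_def)
  define f where "f x = (if x \<le> s then x else if x \<le> u then s + a * (x - s) else v + b * (x - u))"
    for x
  have "(\<lambda>x\<in>{0..1}. f x) \<in> carrier Homeo_plus_I"
  proof (rule Homeo_plus_I_I)
    have "continuous_on ({..s} \<union> {s..}) f"
      unfolding f_def
    proof (rule continuous_on_cases)
      show "continuous_on {s..} (\<lambda>x. if x \<le> u then s + a * (x - s) else v + b * (x - u))"
      proof -
        have "continuous_on ({s..u} \<union> {u..}) (\<lambda>x. if x \<le> u then s + a * (x - s) else v + b * (x - u))"
          by (rule continuous_on_cases) (use au in \<open>auto intro!: continuous_intros\<close>)
        moreover have "{s..u} \<union> {u..} = {s..}" using assms by auto
        ultimately show ?thesis by simp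
      qed
    qed (use assms in \<open>auto intro!: continuous_intros\<close>)
    then show "continuous_on {0..1} f" by (rule continuous_on_subset) auto
    show "f x < f y" if "0 \<le> x" "x < y" "y \<le> 1" for x y
    proof -
      have 1: "a * (x - s) < a * (y - s)" "b * (x - u) < b * (y - u)" using ab that by auto
      have 2: "a * (y - s) > 0" if "y > s" using ab that by simp
      have 3: "b * (y - u) > 0" if "y > u" using ab that by simp
      have 4: "a * (x - s) \<le> a * (u - s)" if "x \<le> u" using ab that by simp
      show ?thesis using 1 2 3 4 that au assms unfolding f_def by auto
    qed
    show "f 0 = 0" using assms by (simp add: f_def)
    show "f 1 = 1" using assms b1 by (simp add: f_def)
  qed
  moreover have "(\<lambda>x\<in>{0..1}. f x) x = x" if "0 \<le> x" "x \<le> s" for x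
    using that assms by (simp add: f_def)
  moreover have "(\<lambda>x\<in>{0..1}. f x) u = v" using assms au by (simp add: f_def)
  ultimately show ?thesis by (rule that)
qed

text \<open>Adding a new largest point \<open>b\<close>, correct the value at \<open>b\<close> by a bump that is the identity
  up to the largest value already prescribed.\<close>

lemma Homeo_plus_I_interpolate:
  fixes P :: "real set"
  assumes "finite P" "P \<subseteq> {0<..<1}" "\<psi> ` P \<subseteq> {0<..<1}" "strict_mono_on P \<psi>"
  shows "\<exists>k\<in>carrier Homeo_plus_I. \<forall>p\<in>P. k p = \<psi> p"
  using assms
proof (induction P rule: finite_linorder_max_induct)
  case empty
  have "\<one>\<^bsub>Homeo_plus_I\<^esub> \<in> carrier Homeo_plus_I"
    by (rule monoid.one_closed[OF group.is_monoid[OF group_Homeo_plus_I]])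
  then show ?case by blast
next
  case (insert b A)
  have "strict_mono_on A \<psi>" using insert.prems(3) by (auto simp: strict_mono_on_def)
  then obtain k where k: "k \<in> carrier Homeo_plus_I" "\<forall>p\<in>A. k p = \<psi> p"
    using insert by auto
  define s where "s = Max (insert 0 (\<psi> ` A))"
  have b: "0 < b" "b < 1" "0 < \<psi> b" "\<psi> b < 1" using insert.prems by auto
  have s_lt: "s < c" if "c > 0" "\<And>a. a \<in> A \<Longrightarrow> \<psi> a < c" for c
    unfolding s_def using insert(1) that by (subst Max_less_iff) auto
  have s_ge: "0 \<le> s" "\<And>a. a \<in> A \<Longrightarrow> \<psi> a \<le> s" unfolding s_def using insert(1) by auto
  have kb: "s < k b"
  proof (rule s_lt)
    show "0 < k b" using Homeo_plus_I_open_interval[OF k(1)] b by simp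
    show "\<psi> a < k b" if "a \<in> A" for a
    proof -
      have "0 \<le> a" "a < b" using insert.prems(1) insert(2) that by auto
      then show ?thesis using Homeo_plus_I_strict_mono[OF k(1), of a b] k(2) that b by auto
    qed
  qed
  have \<psi>b: "s < \<psi> b"
    by (rule s_lt) (use b insert in \<open>auto simp: strict_mono_on_def\<close>)
  obtain j where j: "j \<in> carrier Homeo_plus_I" "\<And>x. 0 \<le> x \<Longrightarrow> x \<le> s \<Longrightarrow> j x = x" "j (k b) = \<psi> b"
    by (rule Homeo_plus_I_bump[of s "k b" "\<psi> b"])
       (use s_ge kb \<psi>b b Homeo_plus_I_open_interval[OF k(1)] in auto)
  have "compose {0..1} j k p = \<psi> p" if "p \<in> insert b A" for p
  proof -
    have "p \<in> {0..1}" using insert.prems(1) that by auto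
    moreover have "j (k p) = \<psi> p"
    proof (cases "p = b")
      case False
      then have "p \<in> A" using that by simp
      moreover from this have "0 \<le> \<psi> p" using insert.prems(2) by (auto intro: less_imp_le)
      ultimately show ?thesis using k(2) j(2) s_ge by simp
    qed (use j in simp)
    ultimately show ?thesis by (simp add: compose_eq)
  qed
  then show ?case using compose_Homeo_plus_I[OF j(1) k(1)] by blast
qed

text \<open>A compact \<open>K\<close> inside a relatively open \<open>V\<close> has positive distance from the complement of \<open>V\<close>, so a map
  uniformly close to the identity still sends \<open>K\<close> into \<open>V\<close>. This treats the subbasic open sets.\<close>

lemma identity_neighbourhood_Homeo_plus_I:
  assumes "openin Homeo_plus_I_topology U" "(\<lambda>x\<in>{0..1}. x) \<in> U"
  obtains \<delta> where "\<delta> > 0"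
    "\<And>h. h \<in> carrier Homeo_plus_I \<Longrightarrow> (\<And>t. t \<in> {0..1} \<Longrightarrow> \<bar>h t - t\<bar> < \<delta>) \<Longrightarrow> h \<in> U"
proof -
  let ?T = "top_of_set {0..1::real}"
  let ?C = "{f. continuous_map ?T ?T f \<and> f \<in> extensional (topspace ?T)}"
  let ?B = "{{f \<in> ?C. f ` K \<subseteq> V} | K V. compactin ?T K \<and> openin ?T V}"
  let ?near = "\<lambda>V. \<exists>\<delta>>0. \<forall>h\<in>carrier Homeo_plus_I. (\<forall>t\<in>{0..1}. \<bar>h t - t\<bar> < \<delta>) \<longrightarrow> h \<in> V"
  have HC: "carrier Homeo_plus_I \<subseteq> ?C"
    using Homeo_plus_I_D by (force simp: continuous_map_in_subtopology Bij_imp_extensional)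
  obtain V where V: "openin (topology_generated_by ?B) V" "U = V \<inter> carrier Homeo_plus_I"
    using assms(1) unfolding Homeo_plus_I_topology_def compact_open_topology_def Let_def openin_subtopology
    by auto
  have "generate_topology_on ?B V" using V(1) by (rule openin_topology_generated_by)
  moreover have "(\<lambda>x\<in>{0..1}. x) \<in> V" using V assms by simp
  ultimately have "?near V"
  proof (induction rule: generate_topology_on.induct)
    case (Int a b)
    then obtain \<delta> \<delta>' where "\<delta> > 0" "\<delta>' > 0"
      "\<forall>h\<in>carrier Homeo_plus_I. (\<forall>t\<in>{0..1}. \<bar>h t - t\<bar> < \<delta>) \<longrightarrow> h \<in> a"
      "\<forall>h\<in>carrier Homeo_plus_I. (\<forall>t\<in>{0..1}. \<bar>h t - t\<bar> < \<delta>') \<longrightarrow> h \<in> b" by auto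
    then show ?case by (intro exI[of _ "min \<delta> \<delta>'"]) auto
  next
    case (UN K)
    then show ?case by (meson UnionE UnionI)
  next
    case (Basis s)
    then obtain K V where KV: "s = {f \<in> ?C. f ` K \<subseteq> V}" "compactin ?T K" "openin ?T V" by auto
    obtain W where W: "open W" "V = {0..1} \<inter> W" using KV(3) by (auto simp: openin_open)
    have K: "compact K" "K \<subseteq> {0..1}" using KV(2) by (auto simp: compactin_subtopology)
    have "(\<lambda>x\<in>{0..1}. x) ` K \<subseteq> V" using Basis(2) KV(1) by blast
    moreover have "(\<lambda>x\<in>{0..1}. x) ` K = K" using K by force
    ultimately have "K \<subseteq> V" by (simp only:)
    then have "K \<subseteq> W" using W by blast
    then obtain \<delta> where \<delta>: "\<delta> > 0" "(\<Union>x\<in>K. ball x \<delta>) \<subseteq> W"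
      using compact_subset_open_imp_ball_epsilon_subset[OF K(1) W(1)] by auto
    have "h \<in> s" if h: "h \<in> carrier Homeo_plus_I" "\<forall>t\<in>{0..1}. \<bar>h t - t\<bar> < \<delta>" for h
    proof -
      have "h x \<in> V" if "x \<in> K" for x
      proof -
        have "h x \<in> ball x \<delta>" using h(2) K that by (auto simp: dist_real_def abs_minus_commute)
        then show ?thesis using \<delta> that W K Homeo_plus_I_D(5)[OF h(1)] by blast
      qed
      then show ?thesis using HC h KV by auto
    qed
    then show ?case using \<delta> by blast
  qed auto
  then show ?thesis using that V by auto
qed

lemma Homeo_plus_I_near_identity:
  assumes h: "h \<in> carrier Homeo_plus_I" and t: "t \<in> {0..1}"
    and pq: "h p = p" "h q = q" "0 \<le> p" "p \<le> t" "t \<le> q" "q \<le> 1" "q - p \<le> \<eta>"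
  shows "\<bar>h t - t\<bar> \<le> \<eta>"
  using Homeo_plus_I_mono[OF h, of p t] Homeo_plus_I_mono[OF h, of t q] pq t by auto

lemma fixes_grid_imp_near_identity:
  assumes h: "h \<in> carrier Homeo_plus_I" and t: "t \<in> {0..1}" and L: "L > 0"
    and grid: "\<And>i. 0 < i \<Longrightarrow> i < L \<Longrightarrow> h (real i / real L) = real i / real L"
  shows "\<bar>h t - t\<bar> \<le> 1 / real L"
proof (cases "t = 1")
  case False
  define i where "i = nat \<lfloor>real L * t\<rfloor>"
  have fl: "0 \<le> \<lfloor>real L * t\<rfloor>" using t by simp
  have i1: "real i \<le> real L * t" "real L * t < real i + 1"
    using fl unfolding i_def by linarith+
  have "real L * t < real L" using False t L by simp
  then have iL: "i < L" using i1 by linarith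
  have grid_fixed: "h (real j / real L) = real j / real L" if "j \<le> L" for j
    using grid[of j] that L Homeo_plus_I_D(3,4)[OF h] by (cases "j = 0"; cases "j = L") auto
  show ?thesis
  proof (rule Homeo_plus_I_near_identity[OF h t grid_fixed grid_fixed])
    show "i \<le> L" "Suc i \<le> L" using iL by auto
  qed (use i1 iL L in \<open>auto simp: field_simps\<close>)
qed (use Homeo_plus_I_D(4)[OF h] in simp)

text \<open>The odd multiples of \<open>1 / (2 N)\<close> are used in place of the multiples of \<open>1 / N\<close> because they avoid
  the cutting points of \<open>[0, 1]\<close> when \<open>N\<close> is a multiple of the number of pieces.\<close>

lemma fixes_offset_grid_imp_near_identity:
  assumes h: "h \<in> carrier Homeo_plus_I" and t: "t \<in> {0..1}" and N: "N > 0"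
    and grid: "\<And>i. i < N \<Longrightarrow> h ((2 * real i + 1) / (2 * real N)) = (2 * real i + 1) / (2 * real N)"
  shows "\<bar>h t - t\<bar> \<le> 1 / real N"
proof -
  define i where "i = nat \<lfloor>real N * t + 1 / 2\<rfloor>"
  have fl: "0 \<le> \<lfloor>real N * t + 1 / 2\<rfloor>" using t by simp
  have i1: "real i \<le> real N * t + 1 / 2" "real N * t + 1 / 2 < real i + 1"
    using fl unfolding i_def by linarith+
  have "real N * t \<le> real N" using t by (simp add: mult_left_le)
  then have iN: "i \<le> N" using i1 by linarith
  define p where "p = (if i = 0 then 0 else (2 * real (i - 1) + 1) / (2 * real N))"
  define q where "q = (if i = N then 1 else (2 * real i + 1) / (2 * real N))"
  have p: "h p = p" using grid[of "i - 1"] iN Homeo_plus_I_D(3)[OF h] by (auto simp: p_def)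
  have q: "h q = q" using grid[of i] iN Homeo_plus_I_D(4)[OF h] by (auto simp: q_def)
  have P: "0 \<le> p" "p \<le> t" "(2 * real i - 1) / (2 * real N) \<le> p"
    using i1 N t by (auto simp: p_def field_simps of_nat_diff)
  have Q: "q \<le> 1" "t \<le> q" "q \<le> (2 * real i + 1) / (2 * real N)"
    using i1 N t iN by (auto simp: q_def field_simps)
  have "(2 * real i + 1) / (2 * real N) - (2 * real i - 1) / (2 * real N) = 1 / real N"
    using N by (simp add: field_simps)
  then have "q - p \<le> 1 / real N" using P(3) Q(3) by linarith
  then show ?thesis using Homeo_plus_I_near_identity[OF h t p q] P Q by simp
qed

text \<open>The right end of the piece \<open>(i / L, (i + 1) / L]\<close> containing \<open>b\<close>; a cutting point is its own right end.\<close>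

definition grid_ceiling :: "nat \<Rightarrow> real \<Rightarrow> real" where
  "grid_ceiling L b = real_of_int \<lceil>real L * b\<rceil> / real L"

lemma grid_ceiling:
  assumes "L > 0"
  shows "b \<le> grid_ceiling L b" "grid_ceiling L b - 1 / real L < b"
    and "b \<le> c \<Longrightarrow> grid_ceiling L b \<le> grid_ceiling L c"
    and "grid_ceiling L b < grid_ceiling L c \<Longrightarrow> grid_ceiling L b \<le> grid_ceiling L c - 1 / real L"
    and "grid_ceiling L (real i / real L) = real i / real L"
proof -
  have "real L * b \<le> real_of_int \<lceil>real L * b\<rceil>" "real_of_int \<lceil>real L * b\<rceil> - 1 < real L * b"
    by linarith+
  then show "b \<le> grid_ceiling L b" "grid_ceiling L b - 1 / real L < b"
    using assms by (simp_all add: grid_ceiling_def field_simps)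
  show "grid_ceiling L b \<le> grid_ceiling L c" if "b \<le> c"
    using that assms by (auto simp: grid_ceiling_def intro!: divide_right_mono ceiling_mono mult_left_mono)
  show "grid_ceiling L b \<le> grid_ceiling L c - 1 / real L" if "grid_ceiling L b < grid_ceiling L c"
  proof -
    have "\<lceil>real L * b\<rceil> < \<lceil>real L * c\<rceil>"
      using that assms by (simp add: grid_ceiling_def divide_less_cancel)
    then have "real_of_int \<lceil>real L * b\<rceil> \<le> real_of_int \<lceil>real L * c\<rceil> - 1" by linarith
    then show ?thesis using assms
      by (simp add: grid_ceiling_def diff_divide_distrib[symmetric] divide_right_mono)
  qed
  show "grid_ceiling L (real i / real L) = real i / real L"
    using assms by (simp add: grid_ceiling_def)
qed

lemma grid_ceiling_cases:
  assumes "L > 0" "0 < b" "b \<le> 1"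
  obtains i where "i < L" "grid_ceiling L b = real (Suc i) / real L" "grid_ceiling L b - 1 / real L = real i / real L"
proof -
  define i where "i = nat (\<lceil>real L * b\<rceil> - 1)"
  have "0 < \<lceil>real L * b\<rceil>" using assms by simp
  moreover have "\<lceil>real L * b\<rceil> \<le> int L" using assms by (simp add: ceiling_le_iff mult_left_le)
  ultimately have i: "i < L" "real (Suc i) = real_of_int \<lceil>real L * b\<rceil>"
    unfolding i_def by linarith+
  then have "grid_ceiling L b = real (Suc i) / real L" by (simp add: grid_ceiling_def)
  then show ?thesis using that[OF i(1)] by (simp add: add_divide_distrib)
qed

text \<open>On each piece the prescribed map is the contraction by the factor \<open>\<eta>\<close> towards the right end. It is
  increasing on the whole interval, so it can be interpolated on \<open>P\<close> and the cutting points.\<close>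

lemma push_right:
  assumes L: "L > 0" and P: "finite P" "P \<subseteq> {0<..<1}" and \<eta>: "0 < \<eta>" "\<eta> \<le> 1"
  obtains g where "g \<in> carrier Homeo_plus_I"
    "\<And>i. 0 < i \<Longrightarrow> i < L \<Longrightarrow> g (real i / real L) = real i / real L"
    "\<And>b. b \<in> P \<Longrightarrow> g b = (1 - \<eta>) * grid_ceiling L b + \<eta> * b"
proof -
  let ?F = "(\<lambda>i. real i / real L) ` {0<..<L}"
  let ?\<psi> = "\<lambda>b. (1 - \<eta>) * grid_ceiling L b + \<eta> * b"
  have sub: "P \<union> ?F \<subseteq> {0<..<1}" using P L by auto
  have le1: "grid_ceiling L b \<le> 1" if "b < 1" for b
    using grid_ceiling(3)[OF L, of b 1] grid_ceiling(5)[OF L, of L] that L by simp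
  have "?\<psi> b \<in> {0<..<1}" if "b \<in> P \<union> ?F" for b
  proof -
    have b: "0 < b" "b < 1" using subsetD[OF sub that] by auto
    have "(1 - \<eta>) * grid_ceiling L b \<le> (1 - \<eta>) * 1"
      using le1[OF b(2)] \<eta> by (intro mult_left_mono) auto
    moreover have "\<eta> * b < \<eta> * 1" using b \<eta> by simp
    moreover have "0 \<le> (1 - \<eta>) * grid_ceiling L b"
      using grid_ceiling(1)[OF L, of b] b \<eta> by (intro mult_nonneg_nonneg) auto
    moreover have "0 < \<eta> * b" using b \<eta> by simp
    ultimately show ?thesis by auto
  qed
  moreover have "strict_mono_on (P \<union> ?F) ?\<psi>"
  proof (rule strict_mono_onI)
    fix b c :: real assume "b < c"
    then have "(1 - \<eta>) * grid_ceiling L b \<le> (1 - \<eta>) * grid_ceiling L c" "\<eta> * b < \<eta> * c"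
      using grid_ceiling(3)[OF L, of b c] \<eta> by (auto intro: mult_left_mono)
    then show "?\<psi> b < ?\<psi> c" by linarith
  qed
  ultimately obtain g where g: "g \<in> carrier Homeo_plus_I" "\<forall>p\<in>P \<union> ?F. g p = ?\<psi> p"
    using Homeo_plus_I_interpolate[of "P \<union> ?F" ?\<psi>] P(1) sub by blast
  show ?thesis
  proof (rule that[OF g(1)])
    show "g (real i / real L) = real i / real L" if "0 < i" "i < L" for i
    proof -
      have "g (real i / real L) = ?\<psi> (real i / real L)" using g(2) that by auto
      moreover have "(1 - \<eta>) * c + \<eta> * c = c" for c by (simp add: algebra_simps)
      ultimately show ?thesis by (simp only: grid_ceiling(5)[OF L])
    qed
    show "g b = ?\<psi> b" if "b \<in> P" for b using g(2) that by blast
  qed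
qed

section \<open>Actions of the homeomorphism group\<close>

locale homeo_action = bijection_group_action "{0..1::real}" "carrier Homeo_plus_I" \<alpha>
  for \<alpha> :: "(real \<Rightarrow> real) \<Rightarrow> 'e::banach \<Rightarrow> 'e"
begin

text \<open>The points \<open>g m b\<close> converge to the right end of the piece of \<open>b\<close>. Choose \<open>I\<close> so far out that, in each piece,
  the points coming from \<open>I\<close> lie to the right of the image under \<open>k\<close> of the left end, and then \<open>J\<close> so far
  out that the points coming from \<open>J\<close>, and also their images under \<open>k\<close>, lie to the right of those coming from \<open>I\<close>
  in the same piece. Applying \<open>k\<close> to the points from \<open>J\<close> alone then does not change the order, so
  some increasing homeomorphism does exactly that and realizes the switch from the identity to \<open>k\<close>.\<close>

lemma pushed_limit_fixed_by_forward_maps: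
  assumes L: "L > 0"
    and B: "\<And>j. finite (B j)" "\<And>j. B j \<subseteq> {0<..<1}" "\<And>j b. b \<in> B j \<Longrightarrow> b < grid_ceiling L b"
    and stab: "\<And>j u. u \<in> carrier Homeo_plus_I \<Longrightarrow> (\<forall>b\<in>B j. u b = b) \<Longrightarrow> dist (\<alpha> u x) x \<le> inverse (Suc j)"
    and g: "\<And>m. g m \<in> carrier Homeo_plus_I"
      "\<And>m j b. j \<le> m \<Longrightarrow> b \<in> B j \<Longrightarrow>
         g m b = (1 - inverse (Suc m)) * grid_ceiling L b + inverse (Suc m) * b"
    and y: "\<And>\<delta> n. \<delta> > 0 \<Longrightarrow> \<exists>I w. finite I \<and> I \<subseteq> {n..} \<and>
           w \<in> convex hull ((\<lambda>m. \<alpha> (g m) x) ` I) \<and> dist w y \<le> \<delta>"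
    and k: "k \<in> carrier Homeo_plus_I"
      "\<And>i. 0 < i \<Longrightarrow> i < L \<Longrightarrow> real i / real L \<le> k (real i / real L) \<and> k (real i / real L) < real (Suc i) / real L"
  shows "\<alpha> k y = y"
proof -
  let ?u = "grid_ceiling L"
  have "dist (\<alpha> k y) y \<le> 0 + \<eta>" if "\<eta> > 0" for \<eta>
  proof -
    define e where "e = \<eta> / 6"
    have e: "e > 0" using \<open>\<eta> > 0\<close> by (simp add: e_def)
    obtain m0 where m0: "inverse (real (Suc m0)) < e" using reals_Archimedean[OF e] by blast
    \<comment> \<open>Only this one finite set matters for the given precision, as it is handled by every \<open>g m\<close> with \<open>m \<ge> m0\<close>.\<close>
    define C where "C = B m0"
    have C: "finite C" "C \<subseteq> {0<..<1}" "\<And>b. b \<in> C \<Longrightarrow> b < ?u b" using B by (auto simp: C_def)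
    have stabC: "dist (\<alpha> h x) x \<le> e" if "h \<in> carrier Homeo_plus_I" "\<And>b. b \<in> C \<Longrightarrow> h b = b" for h
      using stab[OF that(1), of m0] that(2) m0 by (simp add: C_def)
    have gC: "g m b = (1 - inverse (Suc m)) * ?u b + inverse (Suc m) * b" if "m0 \<le> m" "b \<in> C" for m b
      using g(2) that by (simp add: C_def)
    have g_less: "g m b < ?u b" if "m0 \<le> m" "b \<in> C" for m b
    proof -
      have "inverse (real (Suc m)) * (?u b - b) > 0" using C(3)[OF that(2)] by simp
      moreover have "g m b = ?u b - inverse (real (Suc m)) * (?u b - b)"
        unfolding gC[OF that] by (simp only: left_diff_distrib right_diff_distrib)
      ultimately show ?thesis by linarith
    qed
    have g01: "0 < g m b" "g m b < 1" if "b \<in> C" for m b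
      using Homeo_plus_I_open_interval[OF g(1)] C(2) that by auto
    have g_lim: "(\<lambda>m. g m b) \<longlonglongrightarrow> ?u b" if "b \<in> C" for b
    proof -
      have "(\<lambda>m. (1 - inverse (real (Suc m))) * ?u b + inverse (real (Suc m)) * b) \<longlonglongrightarrow> (1 - 0) * ?u b + 0 * b"
        by (intro tendsto_intros LIMSEQ_inverse_real_of_nat)
      moreover have "\<forall>\<^sub>F m in sequentially. (1 - inverse (real (Suc m))) * ?u b + inverse (real (Suc m)) * b = g m b"
        using eventually_ge_at_top[of m0] by eventually_elim (use gC that in auto)
      ultimately show ?thesis using Lim_transform_eventually by fastforce
    qed
    have u01: "0 < ?u b" "?u b \<le> 1" "?u b \<le> k (?u b)" "k (?u b - 1 / real L) < ?u b"
        "?u b - 1 / real L \<le> k (?u b - 1 / real L)" "0 \<le> ?u b - 1 / real L" if b: "b \<in> C" for b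
    proof -
      have b01: "0 < b" "b \<le> 1" using C(2) b by auto
      obtain i where i: "i < L" "?u b = real (Suc i) / real L" "?u b - 1 / real L = real i / real L"
        by (rule grid_ceiling_cases[OF L b01])
      show "0 < ?u b" "?u b \<le> 1" "0 \<le> ?u b - 1 / real L"
        unfolding i(3) unfolding i(2) using i(1) L by auto
      show "?u b \<le> k (?u b)"
        unfolding i(2) using k(2)[of "Suc i"] i(1) Homeo_plus_I_D(4)[OF k(1)] L by (cases "Suc i = L") auto
      show "k (?u b - 1 / real L) < ?u b" "?u b - 1 / real L \<le> k (?u b - 1 / real L)"
        unfolding i(3) unfolding i(2) using k(2)[of i] i(1) Homeo_plus_I_D(3)[OF k(1)] L
        by (cases "i = 0"; auto)+
    qed
    have "\<forall>\<^sub>F m in sequentially. \<forall>b\<in>C. k (?u b - 1 / real L) < g m b"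
      using C(1) by (rule eventually_ball_finite) (use order_tendstoD(1)[OF g_lim] u01(4) in blast)
    then obtain n where n: "\<And>m b. n \<le> m \<Longrightarrow> b \<in> C \<Longrightarrow> k (?u b - 1 / real L) < g m b"
      unfolding eventually_sequentially by blast
    \<comment> \<open>The order of choice matters: \<open>J\<close> has to be far out relative to the finite set \<open>I\<close>.\<close>
    obtain I v where I: "finite I" "I \<subseteq> {max n m0..}" "v \<in> convex hull ((\<lambda>m. \<alpha> (g m) x) ` I)" "dist v y \<le> e"
      using y[OF e] by metis
    have "\<forall>\<^sub>F m in sequentially. \<forall>l\<in>I. \<forall>b\<in>C. \<forall>c\<in>C. ?u b \<le> ?u c \<longrightarrow> g l b < k (g m c) \<and> g l b < g m c"
    proof (intro eventually_ball_finite[OF I(1)] eventually_ball_finite[OF C(1)] ballI)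
      fix l b c assume l: "l \<in> I" and b: "b \<in> C" and c: "c \<in> C"
      show "\<forall>\<^sub>F m in sequentially. ?u b \<le> ?u c \<longrightarrow> g l b < k (g m c) \<and> g l b < g m c"
      proof (cases "?u b \<le> ?u c")
        case True
        have "m0 \<le> l" using I l by auto
        then have less: "g l b < ?u c" using g_less[of l b] b True by simp
        then have "\<forall>\<^sub>F m in sequentially. g l b < g m c" using order_tendstoD(1)[OF g_lim[OF c]] by blast
        moreover have "(\<lambda>m. k (g m c)) \<longlonglongrightarrow> k (?u c)"
        proof (rule continuous_on_tendsto_compose[OF Homeo_plus_I_D(2)[OF k(1)] g_lim[OF c]])
          show "?u c \<in> {0..1}" using u01[OF c] by simp
          show "\<forall>\<^sub>F m in sequentially. g m c \<in> {0..1}" using g01[OF c] by (auto intro!: always_eventually less_imp_le)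
        qed
        then have "\<forall>\<^sub>F m in sequentially. g l b < k (g m c)"
          by (rule order_tendstoD(1)) (use less u01(3)[OF c] in linarith)
        ultimately show ?thesis by eventually_elim simp
      qed simp
    qed
    then obtain n' where n': "\<And>m l b c. n' \<le> m \<Longrightarrow> l \<in> I \<Longrightarrow> b \<in> C \<Longrightarrow> c \<in> C \<Longrightarrow> ?u b \<le> ?u c \<Longrightarrow>
        g l b < k (g m c) \<and> g l b < g m c"
      unfolding eventually_sequentially by blast
    obtain J w where J: "finite J" "J \<subseteq> {max n' m0..}" "w \<in> convex hull ((\<lambda>m. \<alpha> (g m) x) ` J)" "dist w y \<le> e"
      using y[OF e] by metis
    have before: "g l b < g m c" "g l b < k (g m c)" if "l \<in> I" "m \<in> J" "b \<in> C" "c \<in> C" "?u b \<le> ?u c" for l m b c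
      using n'[of m l b c] that J(2) by auto
    have after: "g m c < g l b" "k (g m c) < g l b" if "l \<in> I" "m \<in> J" "b \<in> C" "c \<in> C" "?u c < ?u b" for l m b c
    proof -
      have uc: "?u c \<le> ?u b - 1 / real L" by (rule grid_ceiling(4)[OF L that(5)])
      have gl: "k (?u b - 1 / real L) < g l b" using n[of l b] I(2) that by auto
      have gm: "g m c < ?u c" using g_less[of m c] J(2) that by auto
      show "g m c < g l b" using uc gl gm u01(5)[OF that(3)] by linarith
      have "1 / real L \<ge> 0" by simp
      then have "?u b - 1 / real L \<le> 1" using u01(2)[OF that(3)] by linarith
      then have "k (g m c) < k (?u b - 1 / real L)"
        using Homeo_plus_I_strict_mono[OF k(1), of "g m c" "?u b - 1 / real L"] uc gm g01(1)[OF that(4), of m]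
        by linarith
      then show "k (g m c) < g l b" using gl by linarith
    qed
    define P where "P = (\<lambda>(m, b). g m b) ` (I \<times> C)"
    define R where "R = (\<lambda>(m, b). g m b) ` (J \<times> C)"
    define \<psi> where "\<psi> z = (if z \<in> P then z else k z)" for z
    have PR: "P \<union> R \<subseteq> {0<..<1}" using g01 by (auto simp: P_def R_def)
    have cmp: "(p < r \<and> p < k r) \<or> (r < p \<and> k r < p)" if "p \<in> P" "r \<in> R" for p r
    proof -
      obtain l b m c where *: "p = g l b" "r = g m c" "l \<in> I" "m \<in> J" "b \<in> C" "c \<in> C"
        using \<open>p \<in> P\<close> \<open>r \<in> R\<close> by (auto simp: P_def R_def)
      show ?thesis using before[OF *(3-6)] after[OF *(3-6)] unfolding *(1,2) by (meson not_less)
    qed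
    have "strict_mono_on (P \<union> R) \<psi>"
    proof (rule strict_mono_onI)
      fix z z' assume z: "z \<in> P \<union> R" "z' \<in> P \<union> R" "z < z'"
      have "0 < z" "z' < 1" using subsetD[OF PR z(1)] subsetD[OF PR z(2)] by auto
      then have kz: "k z < k z'" using Homeo_plus_I_strict_mono[OF k(1), of z z'] z(3) by simp
      show "\<psi> z < \<psi> z'"
        using cmp[of z z'] cmp[of z' z] z kz by (auto simp: \<psi>_def)
    qed
    moreover have "\<psi> ` (P \<union> R) \<subseteq> {0<..<1}"
    proof
      fix a assume "a \<in> \<psi> ` (P \<union> R)"
      then obtain z where z: "z \<in> P \<union> R" "a = \<psi> z" by blast
      have "0 < z" "z < 1" using subsetD[OF PR z(1)] by auto
      then show "a \<in> {0<..<1}" using Homeo_plus_I_open_interval[OF k(1), of z] z(2) by (auto simp: \<psi>_def)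
    qed
    moreover have "finite (P \<union> R)" using I(1) J(1) C(1) by (simp add: P_def R_def)
    ultimately obtain k'' where k'': "k'' \<in> carrier Homeo_plus_I" "\<forall>z\<in>P \<union> R. k'' z = \<psi> z"
      using Homeo_plus_I_interpolate[of "P \<union> R" \<psi>] PR by blast
    have "dist (\<alpha> (\<lambda>x\<in>{0..1}. x) y) (\<alpha> k y) \<le> 6 * e"
    proof (rule limit_displacement_by_switching[where B = C, OF _ g(1) stabC I(3,4) J(3,4) id_in_H k(1) k''(1)])
      show "C \<subseteq> {0..1}" using C(2) by auto
      show "k'' (g m b) = (\<lambda>x\<in>{0..1}. x) (g m b)" if "m \<in> I" "b \<in> C" for m b
      proof -
        have "g m b \<in> P" using that by (auto simp: P_def)
        then show ?thesis using k'' g01[OF that(2), of m] by (simp add: \<psi>_def)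
      qed
      show "k'' (g m b) = k (g m b)" if "m \<in> J" "b \<in> C" for m b
      proof -
        have R: "g m b \<in> R" using that by (auto simp: R_def)
        then have "g m b \<notin> P" using cmp[of "g m b" "g m b"] by blast
        then show ?thesis using k'' R by (simp add: \<psi>_def)
      qed
    qed
    then show ?thesis by (simp add: act_id e_def dist_commute)
  qed
  then have "dist (\<alpha> k y) y \<le> 0" by (rule field_le_epsilon)
  then show ?thesis by simp
qed

text \<open>Let \<open>k0\<close> move all inner cutting points strictly forward. Then \<open>k0\<close> composed with a map that hardly moves the
  cutting points is still a forward map, so the stabilizer of \<open>y\<close> contains all homeomorphisms that move the cutting points only a little.
  Along the path of convex combinations from the identity to \<open>h\<close> the image of \<open>y\<close> is therefore locally
  constant.\<close>

lemma fixed_of_fixed_by_forward_maps: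
  assumes L: "L > 0"
    and forward: "\<And>k. k \<in> carrier Homeo_plus_I \<Longrightarrow>
      (\<And>i. 0 < i \<Longrightarrow> i < L \<Longrightarrow> real i / real L \<le> k (real i / real L) \<and> k (real i / real L) < real (Suc i) / real L) \<Longrightarrow>
      \<alpha> k y = y"
    and h: "h \<in> carrier Homeo_plus_I"
  shows "\<alpha> h y = y"
proof -
  let ?F = "(\<lambda>i. real i / real L) ` {0<..<L}"
  have F: "?F \<subseteq> {0<..<1}" by auto
  obtain k0 where k0: "k0 \<in> carrier Homeo_plus_I" "\<And>i. 0 < i \<Longrightarrow> i < L \<Longrightarrow> k0 (real i / real L) = real i / real L + 1 / (2 * real L)"
  proof -
    have "p + 1 / (2 * real L) \<in> {0<..<1}" if "p \<in> ?F" for p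
    proof -
      obtain i where "i \<in> {0<..<L}" and ip: "p = real i / real L" using \<open>p \<in> ?F\<close> by blast
      then have i: "p = real i / real L" "0 < i" "Suc i \<le> L" by simp_all
      have "real i + 1 / 2 < real L" using i(3) by linarith
      then have "(real i + 1 / 2) / real L < 1" using L by simp
      then show ?thesis using i L by (simp add: add_divide_distrib add_pos_pos)
    qed
    then have "(\<lambda>p. p + 1 / (2 * real L)) ` ?F \<subseteq> {0<..<1}" by blast
    then obtain k where "k \<in> carrier Homeo_plus_I" "\<forall>p\<in>?F. k p = p + 1 / (2 * real L)"
      using Homeo_plus_I_interpolate[of ?F "\<lambda>p. p + 1 / (2 * real L)"] F by (auto simp: strict_mono_on_def)
    then show ?thesis using that by auto
  qed
  have k0_bounds: "real i / real L < k0 (real i / real L)" "k0 (real i / real L) < real (Suc i) / real L"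
    if "0 < i" "i < L" for i
    using k0(2)[OF that] L by (auto simp: add_divide_distrib frac_less2)
  have k0y: "\<alpha> k0 y = y"
    by (rule forward[OF k0(1)]) (use k0_bounds in \<open>auto intro: less_imp_le\<close>)
  have near: "\<alpha> k y = y" if k: "k \<in> carrier Homeo_plus_I"
    and b: "\<And>i. 0 < i \<Longrightarrow> i < L \<Longrightarrow> real i / real L < k0 (k (real i / real L)) \<and> k0 (k (real i / real L)) < real (Suc i) / real L" for k
  proof -
    have "\<alpha> (compose {0..1} k0 k) y = y"
      by (rule forward[OF compose_in_H[OF k0(1) k]]) (use b in \<open>auto simp: compose_eq less_imp_le\<close>)
    then have "dist (\<alpha> k0 (\<alpha> k y)) (\<alpha> k0 y) = 0" using act_compose[OF k0(1) k, of y] k0y by simp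
    then show ?thesis using act_dist[OF k0(1), of "\<alpha> k y" y] by simp
  qed
  define hs where "hs s = (\<lambda>t\<in>{0..1}. (1 - s) * t + s * h t)" for s :: real
  have hs: "hs s \<in> carrier Homeo_plus_I" if s: "s \<in> {0..1}" for s
    unfolding hs_def
  proof (rule Homeo_plus_I_I)
    show "continuous_on {0..1} (\<lambda>t. (1 - s) * t + s * h t)"
      by (intro continuous_intros Homeo_plus_I_D(2)[OF h])
    fix t t' :: real assume t: "0 \<le> t" "t < t'" "t' \<le> 1"
    have "h t < h t'" by (rule Homeo_plus_I_strict_mono[OF h t])
    then have 1: "(1 - s) * t \<le> (1 - s) * t'" "s * h t \<le> s * h t'"
      using t s by (auto intro!: mult_left_mono)
    show "(1 - s) * t + s * h t < (1 - s) * t' + s * h t'"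
    proof (cases "s = 0")
      case False
      then have "s * h t < s * h t'" using s \<open>h t < h t'\<close> by simp
      then show ?thesis using 1 by linarith
    qed (use t in simp)
  qed (use Homeo_plus_I_D[OF h] in auto)
  have "\<alpha> (hs 0) y = \<alpha> (hs 1) y"
  proof (rule connected_local_const[where A = "{0..1::real}"])
    show "\<forall>s\<in>{0..1}. \<forall>\<^sub>F s' in at s within {0..1}. \<alpha> (hs s) y = \<alpha> (hs s') y"
    proof
      fix s :: real assume s: "s \<in> {0..1}"
      obtain q where q: "q \<in> carrier Homeo_plus_I" "\<And>t. t \<in> {0..1} \<Longrightarrow> q (hs s t) = t"
          "\<And>t. t \<in> {0..1} \<Longrightarrow> hs s (q t) = t"
        using inverse_in_H[OF hs[OF s]] by blast
      have lim: "((\<lambda>s'. k0 (q (hs s' t))) \<longlongrightarrow> k0 t) (at s within {0..1})" if t: "t \<in> {0..1}" for t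
      proof -
        have ev: "\<forall>\<^sub>F s' in at s within {0..1}. hs s' t \<in> {0..1}"
          unfolding eventually_at_topological
          by (intro exI[of _ UNIV]) (use hs Homeo_plus_I_D(5) t in blast)
        have "((\<lambda>s'. (1 - s') * t + s' * h t) \<longlongrightarrow> (1 - s) * t + s * h t) (at s within {0..1})"
          by (intro tendsto_intros)
        then have 1: "((\<lambda>s'. hs s' t) \<longlongrightarrow> hs s t) (at s within {0..1})" using t by (simp add: hs_def)
        have 2: "((\<lambda>s'. q (hs s' t)) \<longlongrightarrow> q (hs s t)) (at s within {0..1})"
          by (rule continuous_on_tendsto_compose[OF Homeo_plus_I_D(2)[OF q(1)] 1 _ ev])
             (rule Homeo_plus_I_D(5)[OF hs[OF s] t])
        have ev2: "\<forall>\<^sub>F s' in at s within {0..1}. q (hs s' t) \<in> {0..1}"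
          using ev by eventually_elim (rule Homeo_plus_I_D(5)[OF q(1)])
        have "((\<lambda>s'. k0 (q (hs s' t))) \<longlongrightarrow> k0 (q (hs s t))) (at s within {0..1})"
          by (rule continuous_on_tendsto_compose[OF Homeo_plus_I_D(2)[OF k0(1)] 2 _ ev2])
             (use q(2)[OF t] t in simp)
        then show ?thesis using q(2)[OF t] by simp
      qed
      have "\<forall>\<^sub>F s' in at s within {0..1}. \<forall>i\<in>{0<..<L}.
          real i / real L < k0 (q (hs s' (real i / real L))) \<and> k0 (q (hs s' (real i / real L))) < real (Suc i) / real L"
      proof (rule eventually_ball_finite)
        show "\<forall>i\<in>{0<..<L}. \<forall>\<^sub>F s' in at s within {0..1}.
          real i / real L < k0 (q (hs s' (real i / real L))) \<and> k0 (q (hs s' (real i / real L))) < real (Suc i) / real L"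
        proof
          fix i assume i: "i \<in> {0<..<L}"
          then have "real i / real L \<in> {0..1}" by simp
          note l = order_tendstoD[OF lim[OF this]]
          show "\<forall>\<^sub>F s' in at s within {0..1}.
            real i / real L < k0 (q (hs s' (real i / real L))) \<and> k0 (q (hs s' (real i / real L))) < real (Suc i) / real L"
            by (rule eventually_conj[OF l(1) l(2)]) (use k0_bounds[of i] i in auto)
        qed
      qed simp
      moreover have "\<forall>\<^sub>F s' in at s within {0..1}. s' \<in> {0..1}"
        unfolding eventually_at_topological by (intro exI[of _ UNIV]) auto
      ultimately show "\<forall>\<^sub>F s' in at s within {0..1}. \<alpha> (hs s) y = \<alpha> (hs s') y"
      proof eventually_elim
        case (elim s')
        let ?k = "compose {0..1} q (hs s')"
        have k: "?k \<in> carrier Homeo_plus_I" by (rule compose_in_H[OF q(1) hs[OF elim(2)]])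
        have "\<alpha> ?k y = y"
          by (rule near[OF k]) (use elim(1) in \<open>auto simp: compose_eq\<close>)
        moreover have "compose {0..1} (hs s) ?k = hs s'"
          by (rule ext_H[OF compose_in_H[OF hs[OF s] k] hs[OF elim(2)]])
             (use q(3) Homeo_plus_I_D(5)[OF hs[OF elim(2)]] in \<open>simp add: compose_eq\<close>)
        ultimately show ?case using act_compose[OF hs[OF s] k, of y] by simp
      qed
    qed
  qed auto
  moreover have "hs 0 = (\<lambda>t\<in>{0..1}. t)" by (simp add: hs_def)
  moreover have "hs 1 = h"
    by (rule ext_H[OF hs h]) (simp_all add: hs_def)
  ultimately show ?thesis by (simp add: act_id)
qed

end

lemma offset_grid:
  assumes L: "L > 0" and N: "N > 0"
  defines "B \<equiv> (\<lambda>i. (2 * real i + 1) / (2 * real (L * N))) ` {..<L * N}"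
  shows "finite B" "B \<subseteq> {0<..<1}" "\<And>b. b \<in> B \<Longrightarrow> b < grid_ceiling L b"
    and "\<And>u t. u \<in> carrier Homeo_plus_I \<Longrightarrow> \<forall>b\<in>B. u b = b \<Longrightarrow> t \<in> {0..1} \<Longrightarrow> \<bar>u t - t\<bar> \<le> 1 / real N"
proof -
  have LN: "L * N > 0" using L N by simp
  show "finite B" by (simp add: B_def)
  show "B \<subseteq> {0<..<1}"
  proof
    fix b assume "b \<in> B"
    then obtain i where "i < L * N" and ib: "b = (2 * real i + 1) / (2 * real (L * N))"
      unfolding B_def by blast
    then have i: "b = (2 * real i + 1) / (2 * real (L * N))" "Suc i \<le> L * N" by simp_all
    have "real (Suc i) \<le> real (L * N)" using i(2) by (simp only: of_nat_le_iff)
    then show "b \<in> {0<..<1}" using i LN by (simp add: divide_less_eq add_pos_nonneg)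
  qed
  show "b < grid_ceiling L b" if "b \<in> B" for b
  proof -
    obtain i where i: "b = (2 * real i + 1) / (2 * real (L * N))" using \<open>b \<in> B\<close> by (auto simp: B_def)
    have "b \<noteq> grid_ceiling L b"
    proof
      \<comment> \<open>Then \<open>L b\<close> is an integer, and clearing denominators makes an even number equal to the odd \<open>2 i + 1\<close>.\<close>
      assume "b = grid_ceiling L b"
      then have "real L * b = real_of_int \<lceil>real L * b\<rceil>" using L by (simp add: grid_ceiling_def field_simps)
      moreover have "2 * real N * (real L * b) = 2 * real i + 1" using i L N by simp
      ultimately have "2 * real N * real_of_int \<lceil>real L * b\<rceil> = 2 * real i + 1" by metis
      then have "real_of_int (2 * (int N * \<lceil>real L * b\<rceil>)) = real_of_int (2 * int i + 1)" by simp
      then have "2 * (int N * \<lceil>real L * b\<rceil>) = 2 * int i + 1" by (simp only: of_int_eq_iff)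
      then show False by presburger
    qed
    then show ?thesis using grid_ceiling(1)[OF L, of b] by simp
  qed
  show "\<bar>u t - t\<bar> \<le> 1 / real N" if "u \<in> carrier Homeo_plus_I" "\<forall>b\<in>B. u b = b" "t \<in> {0..1}" for u t
  proof -
    have "\<bar>u t - t\<bar> \<le> 1 / real (L * N)"
      by (rule fixes_offset_grid_imp_near_identity[OF that(1,3) LN]) (use that(2) in \<open>auto simp: B_def\<close>)
    also have "\<dots> \<le> 1 / real N" using L N by (simp add: frac_le)
    finally show ?thesis .
  qed
qed

lemma Homeo_plus_I_action_trivial:
  fixes \<alpha> :: "(real \<Rightarrow> real) \<Rightarrow> 'e::banach \<Rightarrow> 'e"
  assumes refl: "reflexive_space TYPE('e)"
    and act: "continuous_affine_isometric_action Homeo_plus_I Homeo_plus_I_topology \<alpha>"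
  shows "trivial_action Homeo_plus_I \<alpha>"
proof -
  let ?H = "carrier Homeo_plus_I"
  have G: "(BijGroup {0..1})\<lparr>carrier := ?H\<rparr> = Homeo_plus_I" by (simp add: Homeo_plus_I_def)
  interpret homeo_action \<alpha>
  proof (intro homeo_action.intro bijection_group_action.intro)
    show "group ((BijGroup {0..1})\<lparr>carrier := ?H\<rparr>)" unfolding G by (rule group_Homeo_plus_I)
    show "?H \<subseteq> Bij {0..1}" using Homeo_plus_I_D(1) by blast
    show "\<alpha> \<in> hom ((BijGroup {0..1})\<lparr>carrier := ?H\<rparr>) AffIso_group"
      using act by (simp add: G continuous_affine_isometric_action_def)
  qed (rule refl)
  have nbhd: "\<exists>N>0. \<forall>h\<in>?H. (\<forall>t\<in>{0..1}. \<bar>h t - t\<bar> \<le> 1 / real N) \<longrightarrow> dist (\<alpha> h x) x \<le> \<epsilon>"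
    if "\<epsilon> > 0" for x \<epsilon>
  proof -
    obtain U where U: "openin Homeo_plus_I_topology U" "(\<lambda>x\<in>{0..1}. x) \<in> U"
        "\<And>h. h \<in> U \<Longrightarrow> dist (\<alpha> h x) x < \<epsilon>"
    proof (rule identity_neighbourhood[of Homeo_plus_I_topology \<epsilon> x])
      show "topspace Homeo_plus_I_topology = ?H" by (rule topspace_Homeo_plus_I_topology)
    qed (use act \<open>\<epsilon> > 0\<close> in \<open>simp_all add: continuous_affine_isometric_action_def\<close>)
    obtain \<delta> where \<delta>: "\<delta> > 0" "\<And>h. h \<in> ?H \<Longrightarrow> (\<And>t. t \<in> {0..1} \<Longrightarrow> \<bar>h t - t\<bar> < \<delta>) \<Longrightarrow> h \<in> U"
      using identity_neighbourhood_Homeo_plus_I[OF U(1,2)] by blast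
    obtain n where n: "inverse (real (Suc n)) < \<delta>" using reals_Archimedean[OF \<delta>(1)] by blast
    have "dist (\<alpha> h x) x \<le> \<epsilon>" if "h \<in> ?H" "\<forall>t\<in>{0..1}. \<bar>h t - t\<bar> \<le> 1 / real (Suc n)" for h
    proof (rule less_imp_le[OF U(3)[OF \<delta>(2)[OF that(1)]]])
      fix t :: real assume "t \<in> {0..1}"
      then have "\<bar>h t - t\<bar> \<le> 1 / real (Suc n)" using that(2) by blast
      then show "\<bar>h t - t\<bar> < \<delta>" using n by (simp add: inverse_eq_divide)
    qed
    then show ?thesis by blast
  qed
  have "\<exists>y. dist y x \<le> \<epsilon> \<and> (\<forall>h\<in>?H. \<alpha> h y = y)" if "\<epsilon> > 0" for x \<epsilon>
  proof -
    obtain L where L: "L > 0"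
      "\<And>h. h \<in> ?H \<Longrightarrow> \<forall>t\<in>{0..1}. \<bar>h t - t\<bar> \<le> 1 / real L \<Longrightarrow> dist (\<alpha> h x) x \<le> \<epsilon>"
      using nbhd[OF \<open>\<epsilon> > 0\<close>, of x] by blast
    have "\<exists>B. finite B \<and> B \<subseteq> {0<..<1} \<and> (\<forall>b\<in>B. b < grid_ceiling L b) \<and>
        (\<forall>u\<in>?H. (\<forall>b\<in>B. u b = b) \<longrightarrow> dist (\<alpha> u x) x \<le> inverse (Suc j))" for j
    proof -
      obtain N where N: "N > 0"
        "\<And>h. h \<in> ?H \<Longrightarrow> \<forall>t\<in>{0..1}. \<bar>h t - t\<bar> \<le> 1 / real N \<Longrightarrow> dist (\<alpha> h x) x \<le> inverse (Suc j)"
        using nbhd[of "inverse (Suc j)" x] by auto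
      show ?thesis
        by (intro exI[of _ "(\<lambda>i. (2 * real i + 1) / (2 * real (L * N))) ` {..<L * N}"] conjI ballI impI N(2))
           (use offset_grid[OF L(1) N(1)] in blast)+
    qed
    then obtain B where B: "\<And>j. finite (B j)" "\<And>j. B j \<subseteq> {0<..<1}" "\<And>j b. b \<in> B j \<Longrightarrow> b < grid_ceiling L b"
        "\<And>j u. u \<in> ?H \<Longrightarrow> \<forall>b\<in>B j. u b = b \<Longrightarrow> dist (\<alpha> u x) x \<le> inverse (Suc j)"
      by metis
    have "\<exists>g. g \<in> ?H \<and> (\<forall>i. 0 < i \<longrightarrow> i < L \<longrightarrow> g (real i / real L) = real i / real L) \<and>
      (\<forall>j b. j \<le> m \<longrightarrow> b \<in> B j \<longrightarrow> g b = (1 - inverse (Suc m)) * grid_ceiling L b + inverse (Suc m) * b)" for m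
    proof -
      have "finite (\<Union>j\<le>m. B j)" "(\<Union>j\<le>m. B j) \<subseteq> {0<..<1}" using B(1,2) by auto
      moreover have "0 < inverse (real (Suc m))" "inverse (real (Suc m)) \<le> 1" by (auto simp: field_simps)
      ultimately obtain g where "g \<in> ?H" "\<And>i. 0 < i \<Longrightarrow> i < L \<Longrightarrow> g (real i / real L) = real i / real L"
          "\<And>b. b \<in> (\<Union>j\<le>m. B j) \<Longrightarrow> g b = (1 - inverse (Suc m)) * grid_ceiling L b + inverse (Suc m) * b"
        using push_right[OF L(1)] by blast
      then show ?thesis by (intro exI[of _ g]) auto
    qed
    then obtain g where g: "\<And>m. g m \<in> ?H"
        "\<And>m i. 0 < i \<Longrightarrow> i < L \<Longrightarrow> g m (real i / real L) = real i / real L"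
        "\<And>m j b. j \<le> m \<Longrightarrow> b \<in> B j \<Longrightarrow> g m b = (1 - inverse (Suc m)) * grid_ceiling L b + inverse (Suc m) * b"
      by metis
    have near: "dist (\<alpha> (g m) x) x \<le> \<epsilon>" for m
      using L(2)[OF g(1)] fixes_grid_imp_near_identity[OF g(1) _ L(1) g(2)] by blast
    obtain y where y: "dist y x \<le> \<epsilon>"
      "\<And>\<delta> n. \<delta> > 0 \<Longrightarrow> \<exists>I w. finite I \<and> I \<subseteq> {n..} \<and>
           w \<in> convex hull ((\<lambda>m. \<alpha> (g m) x) ` I) \<and> dist w y \<le> \<delta>"
      by (rule orbit_limit_point[of g x \<epsilon>, OF near]) (rule that)
    have "\<alpha> k y = y" if "k \<in> ?H"
      "\<And>i. 0 < i \<Longrightarrow> i < L \<Longrightarrow> real i / real L \<le> k (real i / real L) \<and> k (real i / real L) < real (Suc i) / real L"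
      for k
      by (rule pushed_limit_fixed_by_forward_maps[OF L(1) B g(1,3) y(2) that])
    then have "\<alpha> h y = y" if "h \<in> ?H" for h
      by (rule fixed_of_fixed_by_forward_maps[OF L(1) _ that])
    then show ?thesis using y(1) by blast
  qed
  from trivial_of_approximately_fixed[OF this] show ?thesis by (simp add: G)
qed

section \<open>Isometries of the Urysohn sphere\<close>

locale urysohn =
  fixes M :: "'u set" and d :: "'u \<Rightarrow> 'u \<Rightarrow> real"
  assumes urysohn_sphere: "urysohn_sphere M d"

sublocale urysohn \<subseteq> Metric_space M d
  using urysohn_sphere by (simp add: urysohn_sphere_def)

context urysohn
begin

lemma dist_le_1: "x \<in> M \<Longrightarrow> y \<in> M \<Longrightarrow> d x y \<le> 1"
proof -
  assume "x \<in> M" "y \<in> M"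
  then have "(\<lambda>(x, y). d x y) (x, y) \<le> (SUP (x, y)\<in>M \<times> M. d x y)"
    using urysohn_sphere unfolding urysohn_sphere_def by (intro cSUP_upper) auto
  then show ?thesis using urysohn_sphere unfolding urysohn_sphere_def by simp
qed

lemma iso_mem: "h \<in> carrier (Iso_group M d) \<Longrightarrow> x \<in> M \<Longrightarrow> h x \<in> M"
  unfolding Iso_group_def using Bij_imp_funcset[of h M] by auto

lemma iso_dist:
  "h \<in> carrier (Iso_group M d) \<Longrightarrow> x \<in> M \<Longrightarrow> y \<in> M \<Longrightarrow> d (h x) (h y) = d x y"
  unfolding Iso_group_def by auto

text \<open>Homogeneity for finite families; repetitions in \<open>u\<close> cause no conflict because they force repetitions in \<open>v\<close>.\<close>

lemma homogeneous:
  assumes X: "finite X" and u: "u ` X \<subseteq> M" and v: "v ` X \<subseteq> M"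
    and iso: "\<And>x y. x \<in> X \<Longrightarrow> y \<in> X \<Longrightarrow> d (u x) (u y) = d (v x) (v y)"
  shows "\<exists>h\<in>carrier (Iso_group M d). \<forall>x\<in>X. h (u x) = v x"
proof -
  define f where "f = v \<circ> inv_into X u"
  have fu: "f (u x) = v x" if "x \<in> X" for x
  proof -
    have i: "inv_into X u (u x) \<in> X" "u (inv_into X u (u x)) = u x"
      using that by (auto intro: inv_into_into f_inv_into_f)
    then have "d (v (inv_into X u (u x))) (v x) = 0"
      using iso[OF i(1) that] u that by auto
    then show ?thesis using v i that unfolding f_def by (auto simp: image_subset_iff)
  qed
  have hom: "\<And>A f. finite A \<Longrightarrow> A \<subseteq> M \<Longrightarrow> f \<in> A \<rightarrow> M \<Longrightarrow> (\<forall>x\<in>A. \<forall>y\<in>A. d (f x) (f y) = d x y) \<Longrightarrow>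
        (\<exists>g \<in> carrier (Iso_group M d). \<forall>x\<in>A. g x = f x)"
    using urysohn_sphere unfolding urysohn_sphere_def by blast
  have "\<exists>g \<in> carrier (Iso_group M d). \<forall>x\<in>u ` X. g x = f x"
    by (rule hom) (use X u v fu iso in auto)
  then show ?thesis using fu by auto
qed

lemma embeds_countable:
  assumes "Metric_space N e" "countable N" "\<And>x y. x \<in> N \<Longrightarrow> y \<in> N \<Longrightarrow> e x y \<le> 1"
  obtains f where "f ` N \<subseteq> M" "\<And>x y. x \<in> N \<Longrightarrow> y \<in> N \<Longrightarrow> d (f x) (f y) = e x y"
proof -
  interpret N: Metric_space N e by fact
  have "separable_space N.mtopology"
    unfolding separable_space_def using assms(2)
    by (intro exI[of _ N]) (metis N.topspace_mtopology closure_of_topspace order_refl)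
  then show ?thesis
    using urysohn_sphere_universal[OF urysohn_sphere assms(1) _ assms(3)] that by blast
qed

text \<open>The conditions on \<open>r\<close> say that \<open>Q\<close> and the points \<open>\<phi> j\<close>, with \<open>r\<close> as the distances between them, form a
  metric space. Embed it in the sphere by universality and move the copy of the points \<open>\<phi> j\<close> back to its
  place by homogeneity.\<close>

lemma finite_extension:
  assumes Q: "finite Q" "Q \<subseteq> M" and J: "finite J" "\<phi> ` J \<subseteq> M"
    and r: "\<And>q j. q \<in> Q \<Longrightarrow> j \<in> J \<Longrightarrow> 0 < r q j \<and> r q j \<le> 1"
    and t1: "\<And>q q' j. q \<in> Q \<Longrightarrow> q' \<in> Q \<Longrightarrow> j \<in> J \<Longrightarrow> r q j \<le> d q q' + r q' j"
    and t2: "\<And>q i j. q \<in> Q \<Longrightarrow> i \<in> J \<Longrightarrow> j \<in> J \<Longrightarrow> r q i \<le> r q j + d (\<phi> i) (\<phi> j)"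
    and t3: "\<And>q q' j. q \<in> Q \<Longrightarrow> q' \<in> Q \<Longrightarrow> j \<in> J \<Longrightarrow> d q q' \<le> r q j + r q' j"
    and t4: "\<And>q i j. q \<in> Q \<Longrightarrow> i \<in> J \<Longrightarrow> j \<in> J \<Longrightarrow> d (\<phi> i) (\<phi> j) \<le> r q i + r q j"
  obtains k where "k \<in> carrier (Iso_group M d)" "\<And>q j. q \<in> Q \<Longrightarrow> j \<in> J \<Longrightarrow> d (k q) (\<phi> j) = r q j"
proof -
  define R where "R q z = \<bar>r q (inv_into J \<phi> z)\<bar>" for q z
  have R: "R q (\<phi> j) = r q j" if "q \<in> Q" "j \<in> J" for q j
  proof -
    have i: "inv_into J \<phi> (\<phi> j) \<in> J" "\<phi> (inv_into J \<phi> (\<phi> j)) = \<phi> j"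
      using that by (auto intro: inv_into_into f_inv_into_f)
    have "\<phi> j \<in> M" using J that by auto
    then show ?thesis
      using t2[OF that(1) i(1) that(2)] t2[OF that i(1)] r[OF that(1) i(1)] i(2) by (simp add: R_def)
  qed
  \<comment> \<open>The disjoint union of \<open>Q\<close> and the set of values of \<open>\<phi>\<close>. By \<open>t2\<close>, \<open>r\<close> depends on \<open>j\<close> only
    through \<open>\<phi> j\<close>, so \<open>R\<close> extends the metric consistently.\<close>
  define N where "N = Inl ` Q \<union> Inr ` \<phi> ` J"
  define e where "e s t = (case (s, t) of (Inl p, Inl q) \<Rightarrow> d p q | (Inl p, Inr z) \<Rightarrow> R p z
      | (Inr z, Inl p) \<Rightarrow> R p z | (Inr y, Inr z) \<Rightarrow> d y z)" for s t
  have N: "Metric_space N e"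
  proof
    show "0 \<le> e s t" for s t by (auto simp: e_def R_def split: sum.split)
    show "e s t = e t s" for s t by (auto simp: e_def commute split: sum.split)
    show "(e s t = 0) = (s = t)" if "s \<in> N" "t \<in> N" for s t
      using that Q J r by (fastforce simp: N_def e_def R subset_iff image_subset_iff)
    show "e s u \<le> e s t + e t u" if "s \<in> N" "t \<in> N" "u \<in> N" for s t u
    proof -
      have tri: "d x z \<le> d x y + d y z" if "x \<in> Q \<union> \<phi> ` J" "y \<in> Q \<union> \<phi> ` J" "z \<in> Q \<union> \<phi> ` J" for x y z
        using triangle that Q J by blast
      show ?thesis using that
        unfolding N_def
        apply (elim UnE imageE)
               apply (simp_all add: e_def R tri)
             apply (metis t1 t2 t3 t4 commute add.commute)+
        done
    qed
  qed
  have "countable N" using Q J by (auto simp: N_def intro: countable_finite)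
  moreover have "e s t \<le> 1" if "s \<in> N" "t \<in> N" for s t
    using that Q J r dist_le_1 by (fastforce simp: N_def e_def R subset_iff image_subset_iff)
  ultimately obtain f where f: "f ` N \<subseteq> M" "\<And>s t. s \<in> N \<Longrightarrow> t \<in> N \<Longrightarrow> d (f s) (f t) = e s t"
    using embeds_countable[OF N] by metis
  have fJ: "(\<lambda>j. f (Inr (\<phi> j))) ` J \<subseteq> M" using f by (auto simp: N_def)
  have "d (f (Inr (\<phi> i))) (f (Inr (\<phi> j))) = d (\<phi> i) (\<phi> j)" if "i \<in> J" "j \<in> J" for i j
    using f that by (simp add: N_def e_def)
  then obtain h where h: "h \<in> carrier (Iso_group M d)" "\<And>j. j \<in> J \<Longrightarrow> h (f (Inr (\<phi> j))) = \<phi> j"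
    using homogeneous[OF J(1) fJ J(2)] by blast
  have fQ: "f (Inl q) \<in> M" if "q \<in> Q" for q using f that by (auto simp: N_def)
  have "(\<lambda>q. q) ` Q \<subseteq> M" "(\<lambda>q. h (f (Inl q))) ` Q \<subseteq> M" using Q fQ iso_mem[OF h(1)] by auto
  moreover have "d p q = d (h (f (Inl p))) (h (f (Inl q)))" if "p \<in> Q" "q \<in> Q" for p q
    using iso_dist[OF h(1) fQ fQ] f(2)[of "Inl p" "Inl q"] that by (simp add: N_def e_def)
  ultimately obtain k where k: "k \<in> carrier (Iso_group M d)" "\<And>q. q \<in> Q \<Longrightarrow> k q = h (f (Inl q))"
    using homogeneous[OF Q(1), of "\<lambda>q. q" "\<lambda>q. h (f (Inl q))"] by metis
  have "d (k q) (\<phi> j) = r q j" if "q \<in> Q" "j \<in> J" for q j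
  proof -
    have "d (k q) (\<phi> j) = d (h (f (Inl q))) (h (f (Inr (\<phi> j))))" using k h that by simp
    also have "\<dots> = d (f (Inl q)) (f (Inr (\<phi> j)))"
      using iso_dist[OF h(1) fQ] fJ that by auto
    also have "\<dots> = r q j" using f(2) R that by (simp add: N_def e_def)
    finally show ?thesis .
  qed
  then show ?thesis using that k by blast
qed

text \<open>Say that \<open>k\<close> and \<open>l\<close> differ on \<open>Q\<close> by a generic shift by \<open>s\<close> if \<open>d (k p) (l q) = min 1 (d p q + s)\<close> on \<open>Q\<close>.
  A generic shift by \<open>(n + 1) t\<close> splits into one by \<open>n t\<close> and one by \<open>t\<close>: the two prescribed families of
  distances from an intermediate copy of \<open>Q\<close> are compatible, so the extension property provides it.\<close>

lemma small_shift_chain: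
  fixes F :: "('u \<Rightarrow> 'u) \<Rightarrow> 'e::metric_space"
  assumes Q: "finite Q" "Q \<subseteq> M" and "0 < t"
    and step: "\<And>k l. k \<in> carrier (Iso_group M d) \<Longrightarrow> l \<in> carrier (Iso_group M d) \<Longrightarrow>
        (\<And>p q. p \<in> Q \<Longrightarrow> q \<in> Q \<Longrightarrow> d (k p) (l q) = min 1 (d p q + t)) \<Longrightarrow> dist (F k) (F l) \<le> c"
    and n: "n > 0" and kl: "k \<in> carrier (Iso_group M d)" "l \<in> carrier (Iso_group M d)"
    and kl_dist: "\<And>p q. p \<in> Q \<Longrightarrow> q \<in> Q \<Longrightarrow> d (k p) (l q) = min 1 (d p q + real n * t)"
  shows "dist (F k) (F l) \<le> real n * c"
  using n kl kl_dist
proof (induction n arbitrary: k l rule: nat_induct_non_zero)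
  case 1
  then show ?case using step by simp
next
  case (Suc n)
  define T where "T = real n * t"
  let ?J = "Q \<times> {True, False}"
  let ?\<phi> = "\<lambda>(p, s). if s then k p else l p"
  let ?r = "\<lambda>q (p, s). if s then min 1 (d p q + T) else min 1 (d p q + t)"
  have tri: "d x z \<le> d x y + d y z" if "x \<in> Q" "y \<in> Q" "z \<in> Q" for x y z
    using triangle[of x y z] that Q by (auto simp: subset_iff)
  have nt: "T > 0" using Suc(1) \<open>0 < t\<close> by (simp add: T_def)
  have S: "real (Suc n) * t = T + t" by (simp add: T_def algebra_simps)
  have isoQ: "d (k p) (k q) = d p q" "d (l p) (l q) = d p q"
     "d (k p) (l q) = min 1 (d p q + (T + t))" "d (l q) (k p) = min 1 (d p q + (T + t))"
    if "p \<in> Q" "q \<in> Q" for p q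
    using iso_dist Suc(3,4) that Q Suc(5) commute[of "l q"] S by (auto simp: subset_iff)
  obtain m where m: "m \<in> carrier (Iso_group M d)"
      "\<And>q j. q \<in> Q \<Longrightarrow> j \<in> ?J \<Longrightarrow> d (m q) (?\<phi> j) = ?r q j"
  proof (rule finite_extension[of Q ?J ?\<phi> ?r])
    show "?\<phi> ` ?J \<subseteq> M" using iso_mem Suc(3,4) Q by auto
    show "0 < ?r q j \<and> ?r q j \<le> 1" if "q \<in> Q" "j \<in> ?J" for q j
      using that \<open>0 < t\<close> nt nonneg by (auto simp: add_nonneg_pos)
    show "?r q j \<le> d q q' + ?r q' j" if "q \<in> Q" "q' \<in> Q" "j \<in> ?J" for q q' j
      using that tri[of "fst j" q' q] commute[of q q'] by (auto simp: min_def) (smt (verit) nonneg)+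
    show "?r q i \<le> ?r q j + d (?\<phi> i) (?\<phi> j)" if "q \<in> Q" "i \<in> ?J" "j \<in> ?J" for q i j
      using that tri[of "fst i" "fst j" q] commute[of "fst i" "fst j"]  nt \<open>0 < t\<close>
      by (auto simp: isoQ min_def) (smt (verit) nonneg)+
    show "d q q' \<le> ?r q j + ?r q' j" if "q \<in> Q" "q' \<in> Q" "j \<in> ?J" for q q' j
      using that tri[of q "fst j" q'] commute[of q "fst j"]  nt \<open>0 < t\<close> dist_le_1[of q q'] Q
      by (auto simp: min_def subset_iff) (smt (verit) nonneg)+
    show "d (?\<phi> i) (?\<phi> j) \<le> ?r q i + ?r q j" if "q \<in> Q" "i \<in> ?J" "j \<in> ?J" for q i j
      using that tri[of "fst i" q "fst j"] commute[of "fst j" q]  commute[of "fst i" "fst j"]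
        nt \<open>0 < t\<close> dist_le_1[of "fst i" "fst j"] Q
      by (auto simp: isoQ min_def subset_iff) (smt (verit) nonneg commute)+
  qed (use Q in auto)
  have mk: "d (k p) (m q) = min 1 (d p q + T)" and ml: "d (m p) (l q) = min 1 (d p q + t)"
    if "p \<in> Q" "q \<in> Q" for p q
    using m(2)[of q "(p, True)"] m(2)[of p "(q, False)"] that commute by auto
  have "dist (F k) (F m) \<le> real n * c" by (rule Suc.IH) (use Suc m mk in \<open>auto simp: T_def\<close>)
  moreover have "dist (F m) (F l) \<le> c" by (rule step) (use Suc m ml in auto)
  ultimately show ?case using dist_triangle[of "F k" "F l" "F m"] by (simp add: algebra_simps)
qed

text \<open>The copies \<open>k ` Q\<close> and \<open>l ` Q\<close> may be in any position, but there is a third copy at distance \<open>1\<close>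
  from all points of both, and distance \<open>1\<close> is the same as a generic shift by \<open>n t\<close>.\<close>

lemma small_shifts_reach_everything:
  fixes F :: "('u \<Rightarrow> 'u) \<Rightarrow> 'e::metric_space"
  assumes Q: "finite Q" "Q \<subseteq> M" and "0 < t"
    and step: "\<And>k l. k \<in> carrier (Iso_group M d) \<Longrightarrow> l \<in> carrier (Iso_group M d) \<Longrightarrow>
        (\<And>p q. p \<in> Q \<Longrightarrow> q \<in> Q \<Longrightarrow> d (k p) (l q) = min 1 (d p q + t)) \<Longrightarrow> dist (F k) (F l) \<le> c"
    and n: "real n * t \<ge> 1" and kl: "k \<in> carrier (Iso_group M d)" "l \<in> carrier (Iso_group M d)"
  shows "dist (F k) (F l) \<le> 2 * real n * c"
proof -
  let ?J = "Q \<times> {True, False}"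
  let ?\<phi> = "\<lambda>(p, s). if s then k p else l p"
  have \<phi>: "?\<phi> ` ?J \<subseteq> M" using iso_mem kl Q by auto
  have "d p q \<le> 2" if "p \<in> M" "q \<in> M" for p q
    using dist_le_1[OF that] by simp
  then obtain m where m: "m \<in> carrier (Iso_group M d)"
      "\<And>q j. q \<in> Q \<Longrightarrow> j \<in> ?J \<Longrightarrow> d (m q) (?\<phi> j) = 1"
    using finite_extension[OF Q _ \<phi>, of "\<lambda>_ _. 1"] Q \<phi>
    by (auto simp: image_subset_iff subset_iff)
  have one: "1 = min 1 (d p q + real n * t)" for p q using n nonneg[of p q] by (smt (verit))
  have n0: "n > 0" using n by (cases n) auto
  have "dist (F k) (F m) \<le> real n * c"
    by (rule small_shift_chain[OF Q \<open>0 < t\<close> step n0 kl(1) m(1)])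
       (use m(2)[of _ "(_, True)"] one commute in auto)
  moreover have "dist (F l) (F m) \<le> real n * c"
    by (rule small_shift_chain[OF Q \<open>0 < t\<close> step n0 kl(2) m(1)])
       (use m(2)[of _ "(_, False)"] one commute in auto)
  ultimately show ?thesis using dist_triangle[of "F k" "F l" "F m"] by (simp add: dist_commute)
qed

lemma identity_neighbourhood_Iso:
  assumes "openin (Iso_group_topology M d) U" "(\<lambda>x\<in>M. x) \<in> U"
  obtains A \<delta> where "finite A" "A \<subseteq> M" "\<delta> > 0"
    "\<And>h. h \<in> carrier (Iso_group M d) \<Longrightarrow> (\<And>a. a \<in> A \<Longrightarrow> d (h a) a < \<delta>) \<Longrightarrow> h \<in> U"
proof -
  obtain V where V: "openin (product_topology (\<lambda>_. mtopology) M) V" "U = V \<inter> carrier (Iso_group M d)"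
    using assms unfolding Iso_group_topology_def openin_subtopology by auto
  then obtain W where W: "finite {i \<in> M. W i \<noteq> M}" "\<And>i. i \<in> M \<Longrightarrow> openin mtopology (W i)"
      "(\<lambda>x\<in>M. x) \<in> Pi\<^sub>E M W" "Pi\<^sub>E M W \<subseteq> V"
    using assms(2) unfolding openin_product_topology_alt by auto
  define A where "A = {i \<in> M. W i \<noteq> M}"
  have "\<exists>r>0. mball a r \<subseteq> W a" if "a \<in> A" for a
  proof -
    have a: "a \<in> M" using that by (simp add: A_def)
    then have "a \<in> W a" using W(3) by (auto simp: PiE_def Pi_def)
    then show ?thesis using W(2)[OF a] unfolding openin_mtopology by blast
  qed
  then obtain r where r: "\<And>a. a \<in> A \<Longrightarrow> r a > 0" "\<And>a. a \<in> A \<Longrightarrow> mball a (r a) \<subseteq> W a" by metis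
  define \<delta> where "\<delta> = Min (insert 1 (r ` A))"
  have fA: "finite A" using W by (simp add: A_def)
  have "\<delta> > 0" unfolding \<delta>_def using fA r by (subst Min_gr_iff) auto
  moreover have "h \<in> U" if h: "h \<in> carrier (Iso_group M d)" "\<And>a. a \<in> A \<Longrightarrow> d (h a) a < \<delta>" for h
  proof -
    have "h i \<in> W i" if i: "i \<in> M" for i
    proof (cases "i \<in> A")
      case True
      then have "\<delta> \<le> r i" unfolding \<delta>_def using fA by (intro Min_le) auto
      then have "h i \<in> mball i (r i)" using h(2)[OF True] iso_mem[OF h(1) i] i by (simp add: commute)
      then show ?thesis using r True by blast
    next
      case False
      then show ?thesis using iso_mem[OF h(1) i] i by (simp add: A_def)
    qed
    moreover have "h \<in> extensional M" using h(1) by (auto simp: Iso_group_def Bij_def)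
    ultimately show ?thesis using W V h by (auto simp: PiE_def)
  qed
  ultimately show ?thesis using that fA by (auto simp: A_def)
qed

text \<open>The metric \<open>min 1 (d b c + t)\<close> between distinct levels turns countably many copies of the union of the \<open>B m\<close>
  into a countable metric space of diameter at most \<open>1\<close>, which embeds in the sphere. An isometry brings the copy of
  \<open>A\<close> at level \<open>0\<close> back to \<open>A\<close> itself; this makes \<open>g m\<close> move the points of \<open>A\<close> by exactly \<open>t\<close>.\<close>

lemma shifted_copies:
  fixes B :: "nat \<Rightarrow> 'u set"
  assumes A: "finite A" and B: "\<And>m. finite (B m)" "\<And>m. B m \<subseteq> M" "\<And>m. A \<subseteq> B m"
    and t: "0 < t" "t \<le> 1"
  obtains g where "\<And>m. g m \<in> carrier (Iso_group M d)"
    and "\<And>m a. a \<in> A \<Longrightarrow> d (g m a) a = t"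
    and "\<And>m n b c. m \<noteq> n \<Longrightarrow> b \<in> B m \<Longrightarrow> c \<in> B n \<Longrightarrow> d (g m b) (g n c) = min 1 (d b c + t)"
proof -
  define N where "N = (\<Union>m. B m) \<times> (UNIV :: nat set)"
  define e where "e p q = min 1 (d (fst p) (fst q) + (if snd p = snd q then 0 else t))"
    for p q :: "'u \<times> nat"
  have AM: "A \<subseteq> M" using B by blast
  have "(\<Union>m. B m) \<subseteq> M" using B(2) by blast
  then have NM: "fst p \<in> M" if "p \<in> N" for p using that by (auto simp: N_def)
  have "Metric_space N e"
  proof
    show "0 \<le> e p q" for p q using t by (auto simp: e_def)
    show "e p q = e q p" for p q by (auto simp: e_def commute)
    show "(e p q = 0) = (p = q)" if "p \<in> N" "q \<in> N" for p q
    proof -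
      show ?thesis using NM[OF that(1)] NM[OF that(2)] nonneg[of "fst p" "fst q"] t
        by (auto simp: e_def min_def prod_eq_iff) (smt (verit) nonneg)+
    qed
    show "e p s \<le> e p q + e q s" if "p \<in> N" "q \<in> N" "s \<in> N" for p q s
    proof -
      have "d (fst p) (fst s) \<le> d (fst p) (fst q) + d (fst q) (fst s)"
        using NM that by (intro triangle)
      then show ?thesis using nonneg[of "fst p" "fst q"] nonneg[of "fst q" "fst s"] t
        by (auto simp: e_def min_def) (smt (verit) nonneg)+
    qed
  qed
  moreover have "countable N" unfolding N_def
    by (intro countable_SIGMA countable_UN countable_finite[OF B(1)] countableI_type)
  ultimately obtain f where f: "f ` N \<subseteq> M" "\<And>p q. p \<in> N \<Longrightarrow> q \<in> N \<Longrightarrow> d (f p) (f q) = e p q"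
    using embeds_countable[of N e] by (metis (no_types, lifting) e_def min.cobounded1)
  have inN: "(b, n) \<in> N" if "b \<in> B m" for b m n using that by (auto simp: N_def)
  have inNA: "(a, n) \<in> N" if "a \<in> A" for a n using that B inN by blast
  have e0: "e (a, n) (b, n) = d a b" if "a \<in> M" "b \<in> M" for a b n
    using dist_le_1[OF that] by (simp add: e_def)
  have "d (f (a, 0)) (f (b, 0)) = d a b" if "a \<in> A" "b \<in> A" for a b
    using f(2)[OF inNA inNA] e0 that subsetD[OF AM] by simp
  moreover have "(\<lambda>a. f (a, 0)) ` A \<subseteq> M" using f(1) inNA by blast
  ultimately obtain w where w: "w \<in> carrier (Iso_group M d)" "\<And>a. a \<in> A \<Longrightarrow> w (f (a, 0)) = a"
    using homogeneous[OF A, of "\<lambda>a. f (a, 0)" "\<lambda>a. a"] AM by auto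
  have wf: "d (w (f p)) (w (f q)) = e p q" if "p \<in> N" "q \<in> N" for p q
    using iso_dist[OF w(1), of "f p" "f q"] f that by auto
  have "\<exists>g. g \<in> carrier (Iso_group M d) \<and> (\<forall>b\<in>B m. g b = w (f (b, Suc m)))" for m
  proof -
    have "d b c = d (w (f (b, Suc m))) (w (f (c, Suc m)))" if "b \<in> B m" "c \<in> B m" for b c
      using wf[OF inN[OF that(1)] inN[OF that(2)]] e0 subsetD[OF B(2)] that by simp
    moreover have "(\<lambda>b. w (f (b, Suc m))) ` B m \<subseteq> M"
      using iso_mem[OF w(1)] f(1) inN by blast
    moreover have "(\<lambda>b. b) ` B m \<subseteq> M" using B(2) by simp
    ultimately obtain g where "g \<in> carrier (Iso_group M d)" "\<And>b. b \<in> B m \<Longrightarrow> g b = w (f (b, Suc m))"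
      using homogeneous[OF B(1), of "\<lambda>b. b" m "\<lambda>b. w (f (b, Suc m))"] by blast
    then show ?thesis by blast
  qed
  then obtain g where g: "\<And>m. g m \<in> carrier (Iso_group M d)"
      "\<And>m b. b \<in> B m \<Longrightarrow> g m b = w (f (b, Suc m))" by metis
  show ?thesis
  proof (rule that[OF g(1)])
    show "d (g m a) a = t" if "a \<in> A" for m a
    proof -
      have "d (g m a) a = d (w (f (a, Suc m))) (w (f (a, 0)))" 
        using g(2)[of a m] w(2)[of a] subsetD[OF B(3)] that by simp
      also have "\<dots> = e (a, Suc m) (a, 0)" using wf inNA that by blast
      finally show ?thesis using t that subsetD[OF AM that] by (simp add: e_def)
    qed
    show "d (g m b) (g n c) = min 1 (d b c + t)" if "m \<noteq> n" "b \<in> B m" "c \<in> B n" for m n b c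
      using g wf[OF inN inN] that by (simp add: e_def)
  qed
qed

text \<open>With \<open>Q\<close> and \<open>Q'\<close> the points \<open>g m b\<close> for \<open>m \<in> I\<close> and for \<open>m \<in> J\<close>, a switch
  between \<open>k\<close> and \<open>l\<close> is possible as soon as \<open>d (k p) (l q) = d p q\<close> for \<open>p \<in> Q\<close> and \<open>q \<in> Q'\<close>. If
  \<open>k\<close> and \<open>l\<close> differ on \<open>Q\<close> by a generic shift by \<open>t\<close>, a third isometry satisfies this condition
  together with each of them, because the distances between \<open>Q\<close> and \<open>Q'\<close> already contain the
  summand \<open>t\<close>. The resulting bound \<open>12 * e\<close> is
  multiplied by a number of steps that only depends on \<open>t\<close>, hence on \<open>\<epsilon>\<close> and \<open>x\<close> but not on \<open>e\<close>.\<close>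

lemma Iso_urysohn_action_trivial:
  fixes \<alpha> :: "('u \<Rightarrow> 'u) \<Rightarrow> 'e::banach \<Rightarrow> 'e"
  assumes refl: "reflexive_space TYPE('e)"
    and act: "continuous_affine_isometric_action (Iso_group M d) (Iso_group_topology M d) \<alpha>"
  shows "trivial_action (Iso_group M d) \<alpha>"
proof -
  let ?H = "carrier (Iso_group M d)"
  have G: "(BijGroup M)\<lparr>carrier := ?H\<rparr> = Iso_group M d" by (simp add: Iso_group_def)
  interpret bijection_group_action M ?H \<alpha>
  proof (rule bijection_group_action.intro)
    show "group ((BijGroup M)\<lparr>carrier := ?H\<rparr>)" unfolding G by (rule group_Iso_group)
    show "?H \<subseteq> Bij M" by (auto simp: Iso_group_def)
    show "\<alpha> \<in> hom ((BijGroup M)\<lparr>carrier := ?H\<rparr>) AffIso_group"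
      using act by (simp add: G continuous_affine_isometric_action_def)
  qed (rule refl)
  have nbhd: "\<exists>A \<delta>. finite A \<and> A \<subseteq> M \<and> \<delta> > 0 \<and>
      (\<forall>h\<in>?H. (\<forall>a\<in>A. d (h a) a < \<delta>) \<longrightarrow> dist (\<alpha> h x) x < \<epsilon>)" if "\<epsilon> > 0" for x \<epsilon>
  proof -
    obtain U where U: "openin (Iso_group_topology M d) U" "(\<lambda>x\<in>M. x) \<in> U"
        "\<And>h. h \<in> U \<Longrightarrow> dist (\<alpha> h x) x < \<epsilon>"
    proof (rule identity_neighbourhood[of "Iso_group_topology M d" \<epsilon> x])
      show "topspace (Iso_group_topology M d) = ?H"
        by (rule topspace_Iso_group_topology[OF Metric_space_axioms])
    qed (use act \<open>\<epsilon> > 0\<close> in \<open>simp_all add: continuous_affine_isometric_action_def\<close>)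
    show ?thesis using identity_neighbourhood_Iso[OF U(1,2)] U(3) by metis
  qed
  have "\<exists>y. dist y x \<le> \<epsilon> \<and> (\<forall>h\<in>?H. \<alpha> h y = y)" if "\<epsilon> > 0" for x \<epsilon>
  proof -
    obtain A \<delta> where A: "finite A" "A \<subseteq> M" "\<delta> > 0"
        "\<And>h. h \<in> ?H \<Longrightarrow> (\<forall>a\<in>A. d (h a) a < \<delta>) \<Longrightarrow> dist (\<alpha> h x) x < \<epsilon>"
      using nbhd[OF \<open>\<epsilon> > 0\<close>, of x] by metis
    have "\<exists>C. finite C \<and> C \<subseteq> M \<and> (\<forall>h\<in>?H. (\<forall>c\<in>C. h c = c) \<longrightarrow> dist (\<alpha> h x) x \<le> inverse (Suc m))" for m
    proof -
      obtain C \<delta>' where C: "finite C" "C \<subseteq> M" "\<delta>' > 0"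
        "\<And>h. h \<in> ?H \<Longrightarrow> (\<forall>a\<in>C. d (h a) a < \<delta>') \<Longrightarrow> dist (\<alpha> h x) x < inverse (Suc m)"
        using nbhd[of "inverse (Suc m)" x] by auto
      have "dist (\<alpha> h x) x \<le> inverse (Suc m)" if "h \<in> ?H" "\<forall>c\<in>C. h c = c" for h
        using C(2,3) that by (intro less_imp_le C(4)) auto
      then show ?thesis using C by blast
    qed
    then obtain C where C: "\<And>m. finite (C m)" "\<And>m. C m \<subseteq> M"
        "\<And>m h. h \<in> ?H \<Longrightarrow> (\<forall>c\<in>C m. h c = c) \<Longrightarrow> dist (\<alpha> h x) x \<le> inverse (Suc m)" by metis
    \<comment> \<open>Increasing sets, so that each \<open>C j\<close> is shifted by all but finitely many of the \<open>g m\<close>.\<close>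
    define B where "B m = A \<union> (\<Union>j\<le>m. C j)" for m
    have B: "finite (B m)" "B m \<subseteq> M" "A \<subseteq> B m" "m \<le> n \<Longrightarrow> B m \<subseteq> B n" for m n
    proof -
      show "finite (B m)" using A C by (simp add: B_def)
      show "B m \<subseteq> M" using A C unfolding B_def by blast
      show "A \<subseteq> B m" by (simp add: B_def)
      show "B m \<subseteq> B n" if "m \<le> n" using that by (fastforce simp: B_def)
    qed
    \<comment> \<open>The \<open>g m\<close> will move the points of \<open>A\<close> by exactly \<open>t < \<delta>\<close>, hence \<open>x\<close> by less than \<open>\<epsilon>\<close>.\<close>
    define t where "t = min 1 (\<delta> / 2)"
    have t: "0 < t" "t \<le> 1" "t < \<delta>" using A by (auto simp: t_def)
    obtain g where g: "\<And>m. g m \<in> ?H" "\<And>m a. a \<in> A \<Longrightarrow> d (g m a) a = t"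
      "\<And>m n b c. m \<noteq> n \<Longrightarrow> b \<in> B m \<Longrightarrow> c \<in> B n \<Longrightarrow> d (g m b) (g n c) = min 1 (d b c + t)"
      by (rule shifted_copies[of A B t, OF A(1) B(1,2,3) t(1,2)]) (rule that)
    have near: "dist (\<alpha> (g m) x) x \<le> \<epsilon>" for m
      using A(4)[OF g(1)] g(2) t by (simp add: less_imp_le)
    obtain y where y: "dist y x \<le> \<epsilon>"
      "\<And>\<delta> n. \<delta> > 0 \<Longrightarrow> \<exists>I w. finite I \<and> I \<subseteq> {n..} \<and>
           w \<in> convex hull ((\<lambda>m. \<alpha> (g m) x) ` I) \<and> dist w y \<le> \<delta>"
      by (rule orbit_limit_point[of g x \<epsilon>, OF near]) (rule that)
    have "\<alpha> h y = y" if h: "h \<in> ?H" for h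
    proof -
      obtain n :: nat where n: "real n * t \<ge> 1"
        using reals_Archimedean3[OF t(1)] less_imp_le by blast
      then have n0: "n > 0" by (cases n) auto
      have "dist (\<alpha> h y) y \<le> 0 + \<eta>" if "\<eta> > 0" for \<eta>
      proof -
        \<comment> \<open>Each of the \<open>2 n\<close> steps costs \<open>12 * e\<close>.\<close>
        define e where "e = \<eta> / (24 * real n)"
        have e: "e > 0" using \<open>\<eta> > 0\<close> n0 by (simp add: e_def)
        obtain m0 where m0: "inverse (real (Suc m0)) < e" using reals_Archimedean[OF e] by blast
        have stab: "dist (\<alpha> u x) x \<le> e" if "u \<in> ?H" "\<And>b. b \<in> B m0 \<Longrightarrow> u b = b" for u
        proof -
          have "\<forall>c\<in>C m0. u c = c" using that(2) by (auto simp: B_def)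
          from C(3)[OF that(1) this] m0 show ?thesis by linarith
        qed
        obtain I v where I: "finite I" "I \<subseteq> {m0..}" "v \<in> convex hull ((\<lambda>m. \<alpha> (g m) x) ` I)" "dist v y \<le> e"
          using y(2)[OF e] by metis
        obtain J w where J: "finite J" "J \<subseteq> {Suc (Max (insert m0 I))..}"
            "w \<in> convex hull ((\<lambda>m. \<alpha> (g m) x) ` J)" "dist w y \<le> e"
          using y(2)[OF e] by metis
        have less: "m < n" if "m \<in> I" "n \<in> J" for m n
        proof -
          have "m \<le> Max (insert m0 I)" using that I by (intro Max_ge) auto
          then show ?thesis using J that by auto
        qed
        have IB: "b \<in> B m" if "b \<in> B m0" "m \<in> I" for b m using B(4)[of m0 m] I that by auto
        have JB: "b \<in> B m" if "b \<in> B m0" "m \<in> J" for b m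
        proof -
          have "m0 \<le> Max (insert m0 I)" using I by (intro Max_ge) auto
          moreover have "Suc (Max (insert m0 I)) \<le> m" using J(2) that(2) by auto
          ultimately have "m0 \<le> m" by linarith
          then show ?thesis using B(4)[of m0 m] that by blast
        qed
        define Q where "Q = (\<lambda>(m, b). g m b) ` (I \<times> B m0)"
        define Q' where "Q' = (\<lambda>(m, b). g m b) ` (J \<times> B m0)"
        have Q: "finite Q" "Q \<subseteq> M" and Q': "finite Q'" "Q' \<subseteq> M"
          using I J B[of m0] iso_mem[OF g(1)] by (auto simp: Q_def Q'_def subset_iff)
        have far: "0 < d p q" "min 1 (d p p' + t) \<le> d p q + d p' q" if "p \<in> Q" "p' \<in> Q" "q \<in> Q'" for p p' q
        proof -
          obtain m b m' b' n c where *: "p = g m b" "p' = g m' b'" "q = g n c" "m \<in> I" "m' \<in> I" "n \<in> J"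
              "b \<in> B m0" "b' \<in> B m0" "c \<in> B m0"
            using \<open>p \<in> Q\<close> \<open>p' \<in> Q\<close> \<open>q \<in> Q'\<close> by (auto simp: Q_def Q'_def)
          have M: "b \<in> M" "b' \<in> M" "c \<in> M" using * B(2) by blast+
          have ne: "m \<noteq> n" "m' \<noteq> n" using less[OF *(4,6)] less[OF *(5,6)] by auto
          have 1: "d p q = min 1 (d b c + t)"
            unfolding *(1,3) by (rule g(3)[OF ne(1) IB[OF *(7,4)] JB[OF *(9,6)]])
          have 2: "d p' q = min 1 (d b' c + t)"
            unfolding *(2,3) by (rule g(3)[OF ne(2) IB[OF *(8,5)] JB[OF *(9,6)]])
          have 3: "d p p' \<le> d b b' + t"
          proof (cases "m = m'")
            case True
            then show ?thesis using iso_dist[OF g(1) M(1,2), of m] *(1,2) t by simp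
          next
            case False
            then have "d p p' = min 1 (d b b' + t)" 
              unfolding *(1,2) by (rule g(3)[OF _ IB[OF *(7,4)] IB[OF *(8,5)]])
            then show ?thesis by simp
          qed
          have "d b b' \<le> d b c + d b' c" using triangle[of b c b'] M commute[of c b'] by simp
          then show "0 < d p q" "min 1 (d p p' + t) \<le> d p q + d p' q"
            using 1 2 3 nonneg[of b c] nonneg[of b' c] t
            by (smt (verit))+
        qed
        have half: "dist (\<alpha> k y) (\<alpha> l y) \<le> 6 * e"
          if kl: "k \<in> ?H" "l \<in> ?H" "\<And>p q. p \<in> Q \<Longrightarrow> q \<in> Q' \<Longrightarrow> d (k p) (l q) = d p q" for k l
        proof -
          \<comment> \<open>The prescription is an isometry by the assumption on \<open>k\<close> and \<open>l\<close>, so homogeneity extends it to \<open>k''\<close>.\<close>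
          define v' where "v' z = (if z \<in> Q then k z else l z)" for z
          have disj: "q \<notin> Q" if "q \<in> Q'" for q using far(1)[of q q q] that Q Q' by auto
          have v': "d p q = d (v' p) (v' q)" if "p \<in> Q \<union> Q'" "q \<in> Q \<union> Q'" for p q
            using that disj iso_dist[OF kl(1)] iso_dist[OF kl(2)] kl(3) Q(2) Q'(2) commute
            by (auto simp: v'_def subset_iff)
          have "(\<lambda>z. z) ` (Q \<union> Q') \<subseteq> M" "v' ` (Q \<union> Q') \<subseteq> M"
            using Q Q' iso_mem kl by (auto simp: v'_def)
          then obtain k'' where k'': "k'' \<in> ?H" "\<And>z. z \<in> Q \<union> Q' \<Longrightarrow> k'' z = v' z"
            using homogeneous[of "Q \<union> Q'" "\<lambda>z. z" v'] v' Q(1) Q'(1) by (metis finite_UnI)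
          show ?thesis
          proof (rule limit_displacement_by_switching[OF B(2) g(1) stab I(3,4) J(3,4) kl(1,2) k''(1)])
            show "k'' (g m b) = k (g m b)" if "m \<in> I" "b \<in> B m0" for m b
            proof -
              have "g m b \<in> Q" using that by (auto simp: Q_def)
              then show ?thesis using k'' by (simp add: v'_def)
            qed
            show "k'' (g m b) = l (g m b)" if "m \<in> J" "b \<in> B m0" for m b
            proof -
              have "g m b \<in> Q'" using that by (auto simp: Q'_def)
              then show ?thesis using k'' disj by (simp add: v'_def)
            qed
          qed
        qed
        have step: "dist (\<alpha> k y) (\<alpha> l y) \<le> 12 * e"
          if kl: "k \<in> ?H" "l \<in> ?H" "\<And>p q. p \<in> Q \<Longrightarrow> q \<in> Q \<Longrightarrow> d (k p) (l q) = min 1 (d p q + t)" for k l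
        proof -
          let ?J = "Q \<times> {True, False}"
          let ?\<phi> = "\<lambda>(p, s). if s then k p else l p"
          have iso: "d (k p) (k q) = d p q" "d (l p) (l q) = d p q" "d (l q) (k p) = min 1 (d p q + t)"
            if "p \<in> Q" "q \<in> Q" for p q
            using iso_dist kl(1,2) that Q(2) kl(3)[OF that] commute by (auto simp: subset_iff)
          have inM: "fst j \<in> M" "q \<in> M" if "q \<in> Q'" "j \<in> ?J" for q j
            using that Q(2) Q'(2) by auto
          obtain m where m: "m \<in> ?H" "\<And>q j. q \<in> Q' \<Longrightarrow> j \<in> ?J \<Longrightarrow> d (m q) (?\<phi> j) = d q (fst j)"
          proof (rule finite_extension[of Q' ?J ?\<phi> "\<lambda>q j. d q (fst j)"])
            show "?\<phi> ` ?J \<subseteq> M" using iso_mem kl(1,2) Q by auto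
            show "0 < d q (fst j) \<and> d q (fst j) \<le> 1" if "q \<in> Q'" "j \<in> ?J" for q j
              using far(1)[of "fst j" "fst j" q] commute[of q "fst j"] dist_le_1[OF inM(2,1)[OF that]] that
              by auto
            show "d q (fst j) \<le> d q q' + d q' (fst j)" if "q \<in> Q'" "q' \<in> Q'" "j \<in> ?J" for q q' j
              using triangle[of q q' "fst j"] inM that by blast
            show "d q (fst i) \<le> d q (fst j) + d (?\<phi> i) (?\<phi> j)" if "q \<in> Q'" "i \<in> ?J" "j \<in> ?J" for q i j
            proof -
              have "fst i \<in> M" "fst j \<in> M" "q \<in> M" using inM that by blast+
              then have "d q (fst i) \<le> d q (fst j) + d (fst i) (fst j)" "d (fst i) (fst j) \<le> 1"
                using triangle[of q "fst j" "fst i"] commute[of "fst j"] dist_le_1 by auto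
              moreover have "d (fst i) (fst j) \<le> d (?\<phi> i) (?\<phi> j)"
                using that t \<open>d (fst i) (fst j) \<le> 1\<close> commute[of "fst i" "fst j"] by (auto simp: iso kl(3))
              ultimately show ?thesis by linarith
            qed
            show "d q q' \<le> d q (fst j) + d q' (fst j)" if "q \<in> Q'" "q' \<in> Q'" "j \<in> ?J" for q q' j
              using triangle[of q "fst j" q'] commute[of q' "fst j"] inM that by simp
            show "d (?\<phi> i) (?\<phi> j) \<le> d q (fst i) + d q (fst j)" if "q \<in> Q'" "i \<in> ?J" "j \<in> ?J" for q i j
            proof -
              have "fst i \<in> Q" "fst j \<in> Q" using that by auto
              then have "min 1 (d (fst i) (fst j) + t) \<le> d q (fst i) + d q (fst j)"
                using far(2)[of "fst i" "fst j" q] that commute by metis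
              moreover have "d (fst i) (fst j) \<le> 1" 
                by (rule dist_le_1[OF inM(1)[OF that(1,2)] inM(1)[OF that(1,3)]])
              then have "d (?\<phi> i) (?\<phi> j) \<le> min 1 (d (fst i) (fst j) + t)"
                using that t commute[of "fst i" "fst j"] by (auto simp: iso kl(3))
              ultimately show ?thesis by linarith
            qed
          qed (use Q Q' in auto)
          have "d (k p) (m q) = d p q" "d (l p) (m q) = d p q" if "p \<in> Q" "q \<in> Q'" for p q
            using m(2)[of q "(p, True)"] m(2)[of q "(p, False)"] that commute by auto
          then have "dist (\<alpha> k y) (\<alpha> m y) \<le> 6 * e" "dist (\<alpha> l y) (\<alpha> m y) \<le> 6 * e"
            using half kl m(1) by blast+
          then show ?thesis using dist_triangle[of "\<alpha> k y" "\<alpha> l y" "\<alpha> m y"] by (simp add: dist_commute)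
        qed
        have "dist (\<alpha> h y) (\<alpha> (\<lambda>x\<in>M. x) y) \<le> 2 * real n * (12 * e)"
          by (rule small_shifts_reach_everything[OF Q t(1) _ n h id_in_H]) (use step in blast)
        then show ?thesis using n0 by (simp add: act_id e_def)
      qed
      then have "dist (\<alpha> h y) y \<le> 0" by (rule field_le_epsilon)
      then show ?thesis by simp
    qed
    then show ?thesis using y(1) by blast
  qed
  from trivial_of_approximately_fixed[OF this] show ?thesis by (simp add: G)
qed

end

section \<open>Triviality of the actions\<close>

theorem corollary3p2:
  assumes reflexive: "reflexive_space TYPE('e::banach)"
  shows "(\<forall>\<alpha> :: (real \<Rightarrow> real) \<Rightarrow> 'e \<Rightarrow> 'e.
            continuous_affine_isometric_action Homeo_plus_I Homeo_plus_I_topology \<alpha> \<longrightarrow>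
            trivial_action Homeo_plus_I \<alpha>) \<and>
         (\<forall>(M :: 'u set) d. urysohn_sphere M d \<longrightarrow>
            (\<forall>\<alpha> :: ('u \<Rightarrow> 'u) \<Rightarrow> 'e \<Rightarrow> 'e.
               continuous_affine_isometric_action (Iso_group M d) (Iso_group_topology M d) \<alpha> \<longrightarrow>
               trivial_action (Iso_group M d) \<alpha>))"
proof (intro conjI allI impI)
  show "trivial_action Homeo_plus_I \<alpha>"
    if "continuous_affine_isometric_action Homeo_plus_I Homeo_plus_I_topology \<alpha>"
    for \<alpha> :: "(real \<Rightarrow> real) \<Rightarrow> 'e \<Rightarrow> 'e"
    by (rule Homeo_plus_I_action_trivial[OF reflexive that])
  show "trivial_action (Iso_group M d) \<alpha>"
    if "urysohn_sphere M d"
      and "continuous_affine_isometric_action (Iso_group M d) (Iso_group_topology M d) \<alpha>"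
    for M :: "'u set" and d and \<alpha> :: "('u \<Rightarrow> 'u) \<Rightarrow> 'e \<Rightarrow> 'e"
    by (rule urysohn.Iso_urysohn_action_trivial[OF urysohn.intro[OF that(1)] reflexive that(2)])
qed

end
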